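(* Let $C=\langle a,b\rangle$ be an HFP-code of type Q of length $4n$ whose kernel has dimension $2$. Let $H$ be the $4n\times 4n$ binary matrix whose rows are the codewords of $C$ having a $0$ in the first coordinate (in any order), and let $C^T$ (the transpose code of $C$) be the code consisting of the columns of $H$ together with their complements. Then the kernel of $C^T$ has dimension $1$.
   Context: Let $\mathbb{F}=\mathbb{Z}_2$. $\mathbf 0,\mathbf 1$ denote the all-zero and all-one vectors; for a permutation $\pi$ of $\{1,\dots,m\}$ and $v\in\mathbb{F}^m$, $\pi(v)=(v_{\pi^{-1}(1)},\dots,v_{\pi^{-1}(m)})$. A binary Hadamard matrix of order $4n$ is obtained from a $4n\times4n$ matrix with entries $\pm1$ and $HH^T=4nI$ by replacing $+1$ by $0$ and $-1$ by $1$; the binary Hadamard code it defines is the set of its rows together with their complements. A code $C\subseteq\mathbb{F}^m$ with $\mathbf 0\in C$ is propelinear if to each $x\in C$ a coordinate permutation $\pi_x$ is assigned such that for all $x,y\in C$: $x+\pi_x(y)\in C$ and $\pi_x\pi_y=\pi_{x+\pi_x(y)}$; then $x\cdot y:=x+\pi_x(y)$ makes $(C,\cdot)$ a group with identity $\mathbf 0$. An HFP-code of length $4n$ is a propelinear code that is also a binary Hadamard code of length $4n$, with $\pi_{\mathbf 0}=\pi_{\mathbf 1}=\mathrm{id}$ and such that for every $a\in C\setminus\{\mathbf 0,\mathbf 1\}$, $\pi_a$ has no fixed coordinate. An HFP-code $C$ of length $4n$ is of type Q, written $C=\langle a,b\rangle$, if there are $a,b\in C$ generating $(C,\cdot)$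 with $(C,\cdot)$ having presentation $\langle a,b: a^{4n}=\mathbf 0,\ a^{2n}=b^2,\ b^{-1}ab=a^{-1}\rangle$. The kernel of a code $C\subseteq\mathbb{F}^m$ is $K(C)=\{z\in\mathbb{F}^m: C+z=C\}$, a linear subspace. *)

theory Defs
  imports
    "HOL-Analysis.Analysis"
    "HOL-Library.Z2"
    "HOL-Algebra.Generated_Groups"
begin

text \<open>
  Binary words of length \<open>m\<close> are elements of \<open>bit ^ 'm\<close> with \<open>CARD('m) = m\<close>;
  \<open>0\<close> and \<open>1\<close> are the all-zero and all-one words, so \<open>x + 1\<close> is the complement of \<open>x\<close>.
\<close>

definition perm_action :: "('m \<Rightarrow> 'm) \<Rightarrow> bit ^ 'm \<Rightarrow> bit ^ 'm" where
  "perm_action p v = (\<chi> i. v $ (inv_into UNIV p i))"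

definition with_complements :: "(bit ^ 'm) set \<Rightarrow> (bit ^ 'm) set" where
  "with_complements S = S \<union> (\<lambda>x. x + 1) ` S"

definition hadamard_matrix :: "int ^ 'm ^ 'm \<Rightarrow> bool" where
  "hadamard_matrix M \<longleftrightarrow>
     (\<forall>i j. M $ i $ j = 1 \<or> M $ i $ j = - 1) \<and>
     M ** transpose M = mat (int CARD('m))"

definition binary_matrix_of :: "int ^ 'm ^ 'm \<Rightarrow> bit ^ 'm ^ 'm" where
  "binary_matrix_of M = (\<chi> i j. if M $ i $ j = 1 then 0 else 1)"

definition binary_hadamard_code :: "(bit ^ 'm) set \<Rightarrow> bool" where
  "binary_hadamard_code C \<longleftrightarrow>
     (\<exists>M. hadamard_matrix M \<and> C = with_complements (rows (binary_matrix_of M)))"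

definition propelinear_code :: "(bit ^ 'm) set \<Rightarrow> (bit ^ 'm \<Rightarrow> 'm \<Rightarrow> 'm) \<Rightarrow> bool" where
  "propelinear_code C \<pi> \<longleftrightarrow>
     0 \<in> C \<and>
     (\<forall>x\<in>C. bij (\<pi> x)) \<and>
     (\<forall>x\<in>C. \<forall>y\<in>C. x + perm_action (\<pi> x) y \<in> C \<and>
        \<pi> x \<circ> \<pi> y = \<pi> (x + perm_action (\<pi> x) y))"

definition propelinear_group ::
    "(bit ^ 'm) set \<Rightarrow> (bit ^ 'm \<Rightarrow> 'm \<Rightarrow> 'm) \<Rightarrow> (bit ^ 'm) monoid" where
  "propelinear_group C \<pi> =
     \<lparr>carrier = C, mult = (\<lambda>x y. x + perm_action (\<pi> x) y), one = 0\<rparr>"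

definition hfp_code :: "(bit ^ 'm) set \<Rightarrow> (bit ^ 'm \<Rightarrow> 'm \<Rightarrow> 'm) \<Rightarrow> bool" where
  "hfp_code C \<pi> \<longleftrightarrow>
     propelinear_code C \<pi> \<and> binary_hadamard_code C \<and>
     \<pi> 0 = id \<and> \<pi> 1 = id \<and>
     (\<forall>x\<in>C - {0, 1}. \<forall>i. \<pi> x i \<noteq> i)"

text \<open>
  Group presentations. A word in the generators \<open>'g\<close> and their formal inverses is a list of
  pairs \<open>(g, e)\<close>, where \<open>e\<close> is \<open>True\<close> for \<open>g\<close> and \<open>False\<close> for its inverse. The congruence
  \<open>pres_cong R\<close> identifies two words iff they represent the same element of the free group
  modulo the normal closure of the relations \<open>l = r\<close> with \<open>(l, r) \<in> R\<close>.
\<close>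

type_synonym 'g gword = "('g \<times> bool) list"

inductive pres_cong :: "('g gword \<times> 'g gword) set \<Rightarrow> 'g gword \<Rightarrow> 'g gword \<Rightarrow> bool"
  for R :: "('g gword \<times> 'g gword) set" where
  pc_refl: "pres_cong R u u"
| pc_sym: "pres_cong R u v \<Longrightarrow> pres_cong R v u"
| pc_trans: "pres_cong R u v \<Longrightarrow> pres_cong R v w \<Longrightarrow> pres_cong R u w"
| pc_cancel: "pres_cong R (u @ [(g, e), (g, \<not> e)] @ v) (u @ v)"
| pc_relation: "(l, r) \<in> R \<Longrightarrow> pres_cong R (u @ l @ v) (u @ r @ v)"

definition gword_eval :: "('a, 'x) monoid_scheme \<Rightarrow> ('g \<Rightarrow> 'a) \<Rightarrow> 'g gword \<Rightarrow> 'a" where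
  "gword_eval G f w =
     foldr (\<lambda>(g, e) x. (if e then f g else inv\<^bsub>G\<^esub> (f g)) \<otimes>\<^bsub>G\<^esub> x) w \<one>\<^bsub>G\<^esub>"

definition has_presentation ::
    "('a, 'x) monoid_scheme \<Rightarrow> ('g \<Rightarrow> 'a) \<Rightarrow> ('g gword \<times> 'g gword) set \<Rightarrow> bool" where
  "has_presentation G f R \<longleftrightarrow>
     range f \<subseteq> carrier G \<and>
     generate G (range f) = carrier G \<and>
     (\<forall>u v. gword_eval G f u = gword_eval G f v \<longleftrightarrow> pres_cong R u v)"

datatype gen = Gen_a | Gen_b

definition type_Q_relations :: "nat \<Rightarrow> (gen gword \<times> gen gword) set" where
  "type_Q_relations n =
     {(replicate (4 * n) (Gen_a, True), []),
      (replicate (2 * n) (Gen_a, True), [(Gen_b, True), (Gen_b, True)]),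
      ([(Gen_b, False), (Gen_a, True), (Gen_b, True)], [(Gen_a, False)])}"

definition hfp_code_type_Q ::
    "nat \<Rightarrow> (bit ^ 'm) set \<Rightarrow> (bit ^ 'm \<Rightarrow> 'm \<Rightarrow> 'm) \<Rightarrow> bit ^ 'm \<Rightarrow> bit ^ 'm \<Rightarrow> bool" where
  "hfp_code_type_Q n C \<pi> a b \<longleftrightarrow>
     CARD('m) = 4 * n \<and> hfp_code C \<pi> \<and>
     has_presentation (propelinear_group C \<pi>) (case_gen a b) (type_Q_relations n)"

definition code_kernel :: "(bit ^ 'm) set \<Rightarrow> (bit ^ 'm) set" where
  "code_kernel C = {z. (\<lambda>x. x + z) ` C = C}"

lemma subspace_code_kernel: "vec.subspace (code_kernel C)"
proof (rule vec.subspaceI)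
  show z: "0 \<in> code_kernel C"
    by (simp add: code_kernel_def)
  show "x + y \<in> code_kernel C" if "x \<in> code_kernel C" "y \<in> code_kernel C" for x y
  proof -
    have "(\<lambda>c. c + (x + y)) ` C = (\<lambda>c. c + y) ` (\<lambda>c. c + x) ` C"
      by (simp add: image_image add.assoc)
    with that show ?thesis
      by (simp add: code_kernel_def)
  qed
  show "c *s x \<in> code_kernel C" if "x \<in> code_kernel C" for c x
    using that z by (cases c) auto
qed

text \<open>The coordinates are linearly ordered, so the first one is \<open>Min UNIV\<close>.\<close>

definition row_matrix_of_code ::
    "(bit ^ 'm::{finite,linorder}) set \<Rightarrow> bit ^ ('m::{finite,linorder}) ^ ('m::{finite,linorder}) \<Rightarrow> bool" where
  "row_matrix_of_code C H \<longleftrightarrow>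
     bij_betw (\<lambda>i. row i H) UNIV {x \<in> C. x $ Min UNIV = 0}"

definition column_code :: "bit ^ 'm ^ 'm \<Rightarrow> (bit ^ 'm) set" where
  "column_code H = with_complements (columns H)"

end

theory Submission
  imports Defs
begin

text \<open>
  Let \<open>f x\<close> be the first coordinate of \<open>x \<in> C\<close>, and put \<open>s k = f (a\<^sup>k)\<close>, \<open>r k = f (a\<^sup>k b)\<close>. Up to
  adding \<open>f\<close>, the code \<open>C\<close> consists of the right translates of \<open>f\<close> and the transpose code of its
  left translates. A kernel of dimension 2 is invariant under translation by \<open>a\<close>, so it contains a
  nonconstant function \<open>k \<mapsto> c + d k\<close>. Orthogonality of the rows, read as a parity condition on sign
  changes, then forces \<open>d = 1\<close>, \<open>n\<close> even and \<open>r k = s (k - p) + c + k\<close> for some \<open>p\<close>.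

  If the kernel of the transpose code is nontrivial too, it also contains such an affine function: if
  \<open>a\<^sup>w\<close> belongs to it for some nontrivial \<open>w\<close>, then so does \<open>a\<^sup>n\<close>, and summing the \<open>n\<close> translates of the
  corresponding function gives one that changes by 1 at each step. This yields a reflection
  symmetry \<open>s (j - k) = s k + d' k + e\<close>. For even \<open>j\<close> it contradicts \<open>s (k + 2 n) = s k + 1\<close>; for odd
  \<open>j\<close> it makes the even-indexed part of \<open>s\<close> a negacyclic Hadamard sequence of length \<open>n\<close>, which is
  impossible for \<open>n > 2\<close> because its correlations at shifts 1 and 2 prescribe different parities of
  \<open>n / 2\<close>. In the orders \<open>n \<le> 2\<close> the kernel of \<open>C\<close> has dimension greater than 2.
\<close>

declare add_bit_eq_xor [simp del] mult_bit_eq_and [simp del]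

section \<open>Signs and periodic sums\<close>

lemma bit_add_self [simp]: "x + x = (0::bit)"
  by (cases x) auto

lemma bit_add_self_left [simp]: "x + (x + y) = (y::bit)"
  by (simp flip: add.assoc)

lemma bit_add_eq_iff: "x + y = z \<longleftrightarrow> x = y + (z::bit)"
  by (cases x; cases y; cases z) auto

lemma bit_add_eqD: "x + y = z \<Longrightarrow> y = x + (z::bit)"
  by auto

lemma of_int_bit: "(of_int k :: bit) = (if even k then 0 else 1)"
  by (cases "even k") (auto elim!: evenE oddE)

lemma of_nat_bit: "(of_nat k :: bit) = (if even k then 0 else 1)"
  by (cases "even k") (auto elim!: evenE oddE)

lemma bit_affine:
  fixes h :: "int \<Rightarrow> bit"
  assumes "\<And>k. h (k + 1) = h k + d"
  shows "h k = h 0 + d * of_int k"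
proof (induction k rule: int_induct[where k = 0])
  case (step1 i)
  then show ?case using assms[of i] by (simp add: algebra_simps)
next
  case (step2 i)
  have "h i = h (i - 1) + d" using assms[of "i - 1"] by simp
  then have "h (i - 1) = h i + d" by (metis bit_add_self_left add.commute)
  with step2 show ?case by (simp add: algebra_simps)
qed simp

definition sg :: "bit \<Rightarrow> int" where
  "sg x = (if x = 0 then 1 else - 1)"

lemma sg_simps [simp]: "sg 0 = 1" "sg 1 = - 1"
  by (simp_all add: sg_def)

lemma sg_add: "sg (x + y) = sg x * sg y"
  by (cases x; cases y) auto

text \<open>Here \<open>q\<close> counts the indices in \<open>A\<close> with
  \<open>h i = 1\<close>, so one number governs both the integer sum of signs and the sum in the
  field.\<close>

lemma sum_sg: "finite A \<Longrightarrow> \<exists>q. (\<Sum>i\<in>A. sg (h i)) = int (card A) - 2 * int q \<and> (\<Sum>i\<in>A. h i) = of_nat q"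
proof (induction A rule: finite_induct)
  case (insert x A)
  then obtain q where q: "(\<Sum>i\<in>A. sg (h i)) = int (card A) - 2 * int q" "(\<Sum>i\<in>A. h i) = of_nat q"
    by blast
  show ?case
  proof (cases "h x = 0")
    case True
    with insert q show ?thesis by (intro exI[of _ q]) simp
  next
    case False
    with insert q show ?thesis by (intro exI[of _ "Suc q"]) simp
  qed
qed simp

text \<open>A vanishing sum of signs means that exactly half of the \<open>h i\<close> are 1. This
  turns orthogonality of codewords into a parity condition.\<close>

lemma balanced_sum_bit:
  assumes "finite A" "(\<Sum>i\<in>A. sg (h i)) = 0" "card A = 2 * N"
  shows "(\<Sum>i\<in>A. h i) = of_nat N"
  using sum_sg[OF assms(1), of h] assms(2,3) by auto

lemma sum_periodic_shift:
  fixes h :: "int \<Rightarrow> 'a::comm_monoid_add"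
  assumes per: "\<And>k. h (k + int N) = h k"
  shows "(\<Sum>i<N. h (int i + c)) = (\<Sum>i<N. h (int i))"
proof -
  have step: "(\<Sum>i<N. h (int i + (c + 1))) = (\<Sum>i<N. h (int i + c))" for c
  proof (cases N)
    case (Suc M)
    have "(\<Sum>i<N. h (int i + (c + 1))) = (\<Sum>i<M. h (int i + (c + 1))) + h (int M + (c + 1))"
      using Suc by simp
    also have "h (int M + (c + 1)) = h c"
      using per[of c] Suc by (simp add: algebra_simps)
    also have "(\<Sum>i<M. h (int i + (c + 1))) + h c = (\<Sum>i<N. h (int i + c))"
      unfolding Suc sum.lessThan_Suc_shift by (simp add: algebra_simps)
    finally show ?thesis .
  qed simp
  show ?thesis
  proof (induction c rule: int_induct[where k = 0])
    case (step1 i)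
    then show ?case using step[of i] by simp
  next
    case (step2 i)
    then show ?case using step[of "i - 1"] by simp
  qed simp
qed

lemma sum_periodic_reflect:
  fixes h :: "int \<Rightarrow> 'a::comm_monoid_add"
  assumes per: "\<And>k. h (k + int N) = h k"
  shows "(\<Sum>i<N. h (c - int i)) = (\<Sum>i<N. h (int i))"
proof -
  have "(\<Sum>i<N. h (c - int i)) = (\<Sum>i<N. h (c - int (N - Suc i)))"
    by (rule sum.nat_diff_reindex[symmetric])
  also have "\<dots> = (\<Sum>i<N. h (int i + (c + 1)))"
  proof (rule sum.cong)
    fix i assume "i \<in> {..<N}"
    then have "c - int (N - Suc i) + int N = int i + (c + 1)"
      by (auto simp: of_nat_diff)
    then show "h (c - int (N - Suc i)) = h (int i + (c + 1))"
      using per[of "c - int (N - Suc i)"] by metis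
  qed simp
  finally show ?thesis
    by (simp add: sum_periodic_shift[where h = h, OF per])
qed

text \<open>Telescoping; together with \<open>balanced_sum_bit\<close> it computes a parity of sign
  changes from boundary values alone.\<close>

lemma sum_bit_shift_diff:
  fixes h :: "int \<Rightarrow> bit"
  shows "(\<Sum>i<N. h (int i) + h (int i + 1)) = h 0 + h (int N)"
  by (induction N) (simp_all add: ac_simps)

lemma sum_bit_shift2_diff:
  fixes h :: "int \<Rightarrow> bit"
  shows "(\<Sum>i<N. h (int i) + h (int i + 2)) = h 0 + h 1 + (h (int N) + h (int N + 1))"
proof (induction N)
  case (Suc N)
  have "int (Suc N) + 1 = int N + 2" by simp
  with Suc show ?case by (simp add: ac_simps)
qed simp

section \<open>Pairs of negaperiodic sequences\<close>

text \<open>These pairs correspond to the words 0 and 1, the trivial elements of the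
  kernels.\<close>

definition const_pair :: "(int \<Rightarrow> bit) \<Rightarrow> (int \<Rightarrow> bit) \<Rightarrow> bool" where
  "const_pair t t' \<longleftrightarrow> (\<exists>c. \<forall>k. t k = c \<and> t' k = c)"

locale negaperiodic_pair =
  fixes n :: nat and s r :: "int \<Rightarrow> bit"
  assumes n_pos: "n > 0"
    and s_period: "s (k + 2 * int n) = s k + 1"
    and r_period: "r (k + 2 * int n) = r k + 1"
begin

text \<open>
  A pair \<open>(x, y)\<close> stands for the function on the dicyclic group with the value \<open>x k\<close> at \<open>a\<^sup>k\<close> and
  \<open>y k\<close> at \<open>a\<^sup>k b\<close>. The alternatives are translation by \<open>a\<^sup>p\<close> and by \<open>a\<^sup>p b\<close>; the summand 1 comes from
  \<open>b\<^sup>2 = a\<^bsup>2n\<^esup>\<close>.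
\<close>

definition right_translate :: "(int \<Rightarrow> bit) \<Rightarrow> (int \<Rightarrow> bit) \<Rightarrow> bool" where
  "right_translate x y \<longleftrightarrow>
     (\<exists>p. (\<forall>k. x k = s (k + p) \<and> y k = r (k - p)) \<or>
          (\<forall>k. x k = r (k + p) \<and> y k = s (k - p) + 1))"

definition left_translate :: "(int \<Rightarrow> bit) \<Rightarrow> (int \<Rightarrow> bit) \<Rightarrow> bool" where
  "left_translate x y \<longleftrightarrow>
     (\<exists>p. (\<forall>k. x k = s (k + p) \<and> y k = r (k + p)) \<or>
          (\<forall>k. x k = r (p - k) \<and> y k = s (p - k) + 1))"

definition right_kernel :: "(int \<Rightarrow> bit) \<Rightarrow> (int \<Rightarrow> bit) \<Rightarrow> bool" where
  "right_kernel t t' \<longleftrightarrow>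
     (\<forall>x y. right_translate x y \<longrightarrow> right_translate (\<lambda>k. x k + t k) (\<lambda>k. y k + t' k))"

definition left_kernel :: "(int \<Rightarrow> bit) \<Rightarrow> (int \<Rightarrow> bit) \<Rightarrow> bool" where
  "left_kernel t t' \<longleftrightarrow>
     (\<forall>x y. left_translate x y \<longrightarrow> left_translate (\<lambda>k. x k + t k) (\<lambda>k. y k + t' k))"

lemma period_mult:
  assumes "\<And>k. h (k + 2 * int n) = h k + (1::bit)"
  shows "h (k + 2 * int n * q) = h k + of_int q"
proof (induction q rule: int_induct[where k = 0])
  case (step1 i)
  then show ?case using assms[of "k + 2 * int n * i"] by (simp add: algebra_simps)
next
  case (step2 i)
  then show ?case using assms[of "k + 2 * int n * (i - 1)"]
    by (simp add: algebra_simps bit_add_eq_iff)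
qed simp

lemmas s_period_mult = period_mult[of s, OF s_period]
lemmas r_period_mult = period_mult[of r, OF r_period]

lemma period_minus: "s (k - 2 * int n) = s k + 1" "r (k - 2 * int n) = r k + 1"
  using s_period[of "k - 2 * int n"] r_period[of "k - 2 * int n"] by (simp_all add: ac_simps)

lemma right_translate_cong:
  "right_translate x y \<Longrightarrow> (\<And>k. x' k = x k) \<Longrightarrow> (\<And>k. y' k = y k) \<Longrightarrow> right_translate x' y'"
  by (simp add: right_translate_def)

lemma left_translate_cong:
  "left_translate x y \<Longrightarrow> (\<And>k. x' k = x k) \<Longrightarrow> (\<And>k. y' k = y k) \<Longrightarrow> left_translate x' y'"
  by (simp add: left_translate_def)

lemma right_translate_self: "right_translate s r"
  unfolding right_translate_def by (rule exI[of _ 0]) simp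

lemma left_translate_self: "left_translate s r"
  unfolding left_translate_def by (rule exI[of _ 0]) simp

text \<open>Translation by the central element \<open>a^(2n)\<close> adds 1 to both
  sequences.\<close>

lemma right_translate_const:
  assumes "right_translate x y" shows "right_translate (\<lambda>k. x k + c) (\<lambda>k. y k + c)"
proof (cases "c = 0")
  case False
  then have c: "c = 1" by simp
  from assms obtain p where
    "(\<forall>k. x k = s (k + p) \<and> y k = r (k - p)) \<or> (\<forall>k. x k = r (k + p) \<and> y k = s (k - p) + 1)"
    unfolding right_translate_def by blast
  moreover have "s (k + (p + 2 * int n)) = s (k + p) + 1" "r (k + (p + 2 * int n)) = r (k + p) + 1"
     "s (k - (p + 2 * int n)) = s (k - p) + 1" "r (k - (p + 2 * int n)) = r (k - p) + 1" for k
    using s_period[of "k + p"] r_period[of "k + p"] period_minus[of "k - p"]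
    by (simp_all add: algebra_simps)
  ultimately show ?thesis
    unfolding right_translate_def c by (intro exI[of _ "p + 2 * int n"]) (elim disjE; simp add: ac_simps)
qed (use assms in simp)

lemma left_translate_const:
  assumes "left_translate x y" shows "left_translate (\<lambda>k. x k + c) (\<lambda>k. y k + c)"
proof (cases "c = 0")
  case False
  then have c: "c = 1" by simp
  from assms obtain p where
    "(\<forall>k. x k = s (k + p) \<and> y k = r (k + p)) \<or> (\<forall>k. x k = r (p - k) \<and> y k = s (p - k) + 1)"
    unfolding left_translate_def by blast
  moreover have "s (k + (p + 2 * int n)) = s (k + p) + 1" "r (k + (p + 2 * int n)) = r (k + p) + 1"
     "s (p + 2 * int n - k) = s (p - k) + 1" "r (p + 2 * int n - k) = r (p - k) + 1" for k
    using s_period[of "k + p"] r_period[of "k + p"] s_period[of "p - k"] r_period[of "p - k"]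
    by (simp_all add: algebra_simps)
  ultimately show ?thesis
    unfolding left_translate_def c by (intro exI[of _ "p + 2 * int n"]) (elim disjE; simp add: ac_simps)
qed (use assms in simp)

lemma right_translate_shift:
  assumes "right_translate x y" shows "right_translate (\<lambda>k. x (k + q)) (\<lambda>k. y (k - q))"
proof -
  from assms obtain p where
    "(\<forall>k. x k = s (k + p) \<and> y k = r (k - p)) \<or> (\<forall>k. x k = r (k + p) \<and> y k = s (k - p) + 1)"
    unfolding right_translate_def by blast
  then show ?thesis
    unfolding right_translate_def by (intro exI[of _ "p + q"]) (auto simp: algebra_simps)
qed

text \<open>Substitutes \<open>h a^q b\<close> for the group element \<open>h\<close>; the summand 1
  comes from \<open>a^k b a^q b = a^(k-q) b^2\<close>.\<close>

lemma right_translate_swap: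
  assumes "right_translate x y" shows "right_translate (\<lambda>k. y (k + q)) (\<lambda>k. x (k - q) + 1)"
proof -
  from assms obtain p where
    "(\<forall>k. x k = s (k + p) \<and> y k = r (k - p)) \<or> (\<forall>k. x k = r (k + p) \<and> y k = s (k - p) + 1)"
    unfolding right_translate_def by blast
  then show ?thesis
  proof
    assume "\<forall>k. x k = s (k + p) \<and> y k = r (k - p)"
    then show ?thesis
      unfolding right_translate_def by (intro exI[of _ "q - p"]) (auto simp: algebra_simps)
  next
    assume *: "\<forall>k. x k = r (k + p) \<and> y k = s (k - p) + 1"
    have "right_translate (\<lambda>k. s (k + (q - p)) + 1) (\<lambda>k. r (k - (q - p)) + 1)"
      by (intro right_translate_const right_translate_shift right_translate_self)
    then show ?thesis
      by (rule right_translate_cong) (simp_all add: * algebra_simps)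
  qed
qed

lemma left_translate_shift:
  assumes "left_translate x y" shows "left_translate (\<lambda>k. x (k + q)) (\<lambda>k. y (k + q))"
proof -
  from assms obtain p where
    "(\<forall>k. x k = s (k + p) \<and> y k = r (k + p)) \<or> (\<forall>k. x k = r (p - k) \<and> y k = s (p - k) + 1)"
    unfolding left_translate_def by blast
  then show ?thesis
  proof
    assume "\<forall>k. x k = s (k + p) \<and> y k = r (k + p)"
    then show ?thesis
      unfolding left_translate_def by (intro exI[of _ "p + q"]) (auto simp: algebra_simps)
  next
    assume "\<forall>k. x k = r (p - k) \<and> y k = s (p - k) + 1"
    then show ?thesis
      unfolding left_translate_def by (intro exI[of _ "p - q"]) (auto simp: algebra_simps)
  qed
qed

text \<open>Substitutes \<open>a^q b h\<close> for \<open>h\<close>. As \<open>b\<close> inverts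
  \<open>a\<close>, the exponent is reflected instead of shifted.\<close>

lemma left_translate_swap:
  assumes "left_translate x y" shows "left_translate (\<lambda>k. y (q - k)) (\<lambda>k. x (q - k) + 1)"
proof -
  from assms obtain p where
    "(\<forall>k. x k = s (k + p) \<and> y k = r (k + p)) \<or> (\<forall>k. x k = r (p - k) \<and> y k = s (p - k) + 1)"
    unfolding left_translate_def by blast
  then show ?thesis
  proof
    assume "\<forall>k. x k = s (k + p) \<and> y k = r (k + p)"
    then show ?thesis
      unfolding left_translate_def by (intro exI[of _ "q + p"]) (auto simp: algebra_simps)
  next
    assume *: "\<forall>k. x k = r (p - k) \<and> y k = s (p - k) + 1"
    have "left_translate (\<lambda>k. s (k + (p - q)) + 1) (\<lambda>k. r (k + (p - q)) + 1)"
      by (intro left_translate_const left_translate_shift left_translate_self)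
    then show ?thesis
      by (rule left_translate_cong) (simp_all add: * algebra_simps)
  qed
qed

section \<open>Behaviour of the two kernels under translation\<close>

lemma right_kernel_shift:
  assumes "right_kernel t t'" shows "right_kernel (\<lambda>k. t (k + q)) (\<lambda>k. t' (k - q))"
  unfolding right_kernel_def
proof (intro allI impI)
  fix x y assume "right_translate x y"
  then have "right_translate (\<lambda>k. x (k + (- q))) (\<lambda>k. y (k - (- q)))"
    by (rule right_translate_shift)
  then have "right_translate (\<lambda>k. x (k + (- q)) + t k) (\<lambda>k. y (k - (- q)) + t' k)"
    using assms unfolding right_kernel_def by blast
  from right_translate_shift[OF this, of q]
  show "right_translate (\<lambda>k. x k + t (k + q)) (\<lambda>k. y k + t' (k - q))"
    by (rule right_translate_cong) simp_all
qed

text \<open>All right translates arise from the base pair by shifts and swaps, and these change an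
  affine pair with common slope only by a constant. Hence testing the base pair suffices.\<close>

lemma right_kernel_affine:
  assumes "right_translate (\<lambda>k. s k + (c + d * of_int k)) (\<lambda>k. r k + (c' + d * of_int k))"
  shows "right_kernel (\<lambda>k. c + d * of_int k) (\<lambda>k. c' + d * of_int k)"
  unfolding right_kernel_def
proof (intro allI impI)
  fix x y assume "right_translate x y"
  then obtain p where
    "(\<forall>k. x k = s (k + p) \<and> y k = r (k - p)) \<or> (\<forall>k. x k = r (k + p) \<and> y k = s (k - p) + 1)"
    unfolding right_translate_def by blast
  then show "right_translate (\<lambda>k. x k + (c + d * of_int k)) (\<lambda>k. y k + (c' + d * of_int k))"
  proof
    assume *: "\<forall>k. x k = s (k + p) \<and> y k = r (k - p)"
    from right_translate_const[OF right_translate_shift[OF assms, of p], of "d * of_int p"]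
    show ?thesis
      by (rule right_translate_cong) (simp_all add: * algebra_simps)
  next
    assume *: "\<forall>k. x k = r (k + p) \<and> y k = s (k - p) + 1"
    from right_translate_const[OF right_translate_swap[OF assms, of p], of "c + c' + d * of_int p"]
    show ?thesis
      by (rule right_translate_cong) (simp_all add: * algebra_simps)
  qed
qed

lemma left_kernelD:
  "left_kernel t t' \<Longrightarrow> left_translate x y \<Longrightarrow> left_translate (\<lambda>k. x k + t k) (\<lambda>k. y k + t' k)"
  by (simp add: left_kernel_def)

lemma left_kernel_shift:
  assumes "left_kernel t t'" shows "left_kernel (\<lambda>k. t (k + q)) (\<lambda>k. t' (k + q))"
  unfolding left_kernel_def
proof (intro allI impI)
  fix x y assume "left_translate x y"
  from left_translate_shift[OF left_kernelD[OF assms left_translate_shift[OF this, of "- q"]], of q]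
  show "left_translate (\<lambda>k. x k + t (k + q)) (\<lambda>k. y k + t' (k + q))"
    by (rule left_translate_cong) simp_all
qed

text \<open>Conjugation by the swap. Two swaps with the same \<open>q\<close> restore a pair up to
  adding 1, which \<open>left_translate_const\<close> removes.\<close>

lemma left_kernel_swap:
  assumes "left_kernel t t'" shows "left_kernel (\<lambda>k. t' (q - k)) (\<lambda>k. t (q - k))"
  unfolding left_kernel_def
proof (intro allI impI)
  fix x y assume "left_translate x y"
  from left_translate_const[OF left_translate_swap[OF
      left_kernelD[OF assms left_translate_swap[OF this, of q]], of q], of 1]
  show "left_translate (\<lambda>k. x k + t' (q - k)) (\<lambda>k. y k + t (q - k))"
    by (rule left_translate_cong) (simp_all add: ac_simps)
qed

lemma left_kernel_cong:
  "left_kernel x y \<Longrightarrow> (\<And>k. x' k = x k) \<Longrightarrow> (\<And>k. y' k = y k) \<Longrightarrow> left_kernel x' y'"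
  by (simp add: left_kernel_def)

lemma left_kernel_add:
  assumes "left_kernel t t'" "left_kernel v v'"
  shows "left_kernel (\<lambda>k. t k + v k) (\<lambda>k. t' k + v' k)"
  unfolding left_kernel_def
proof (intro allI impI)
  fix x y assume "left_translate x y"
  from left_kernelD[OF assms(2) left_kernelD[OF assms(1) this]]
  show "left_translate (\<lambda>k. x k + (t k + v k)) (\<lambda>k. y k + (t' k + v' k))"
    by (rule left_translate_cong) (simp_all add: ac_simps)
qed

lemma left_kernel_zero: "left_kernel (\<lambda>k. 0) (\<lambda>k. 0)"
  by (simp add: left_kernel_def)

lemma left_kernel_sum:
  assumes "\<And>i. i \<in> A \<Longrightarrow> left_kernel (t i) (t' i)" "finite A"
  shows "left_kernel (\<lambda>k. \<Sum>i\<in>A. t i k) (\<lambda>k. \<Sum>i\<in>A. t' i k)"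
  using assms(2,1)
  by (induction A rule: finite_induct) (simp_all add: left_kernel_zero left_kernel_add)

end

section \<open>Orthogonality as vanishing autocorrelation\<close>

locale orthogonal_negaperiodic_pair = negaperiodic_pair +
  assumes orth: "\<not> 2 * int n dvd m \<Longrightarrow>
    (\<Sum>i<2 * n. sg (s (int i) + s (int i + m)) + sg (r (int i) + r (int i + m))) = 0"
begin

text \<open>If the shift by \<open>m\<close> only adds a constant, all terms of the autocorrelation
  have the same sign, and their sum is \<open>4 n\<close> or \<open>- 4 n\<close> instead of
  0.\<close>

lemma shift_invariant_dvd:
  assumes "\<And>k. s (k + m) = s k + c" "\<And>k. r (k + m) = r k + c"
  shows "2 * int n dvd m"
proof (rule ccontr)
  assume "\<not> 2 * int n dvd m"
  from orth[OF this] have "(\<Sum>i<2 * n. sg c + sg c) = 0"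
    by (simp add: assms)
  then show False
    using n_pos by (cases "c = 0") auto
qed

end

section \<open>Pairs whose right kernel has one nontrivial class modulo constants\<close>

locale small_kernel_pair = orthogonal_negaperiodic_pair +
  assumes right_kernel_nontrivial: "\<exists>t t'. right_kernel t t' \<and> \<not> const_pair t t'"
    and right_kernel_unique:
      "right_kernel t t' \<Longrightarrow> right_kernel v v' \<Longrightarrow> \<not> const_pair t t' \<Longrightarrow> \<not> const_pair v v' \<Longrightarrow>
        const_pair (\<lambda>k. t k + v k) (\<lambda>k. t' k + v' k)"
begin

text \<open>The shift of a nonconstant kernel element by 1 is another one, so by uniqueness the two
  differ by a constant \<open>d\<close>, the same for both components. This makes both components
  affine with slope \<open>d\<close>.\<close>

lemma right_kernel_affine_ex:
  obtains c c' d where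
    "right_kernel (\<lambda>k. c + d * of_int k) (\<lambda>k. c' + d * of_int k)" "d = 0 \<Longrightarrow> c \<noteq> c'"
proof -
  obtain t t' where t: "right_kernel t t'" "\<not> const_pair t t'"
    using right_kernel_nontrivial by blast
  note t1 = right_kernel_shift[OF t(1), of 1]
  have nc: "\<not> const_pair (\<lambda>k. t (k + 1)) (\<lambda>k. t' (k - 1))"
  proof
    assume "const_pair (\<lambda>k. t (k + 1)) (\<lambda>k. t' (k - 1))"
    then obtain c where c: "\<And>k. t (k + 1) = c" "\<And>k. t' (k - 1) = c"
      unfolding const_pair_def by blast
    have "t k = c" "t' k = c" for k
      using c(1)[of "k - 1"] c(2)[of "k + 1"] by simp_all
    with t(2) show False unfolding const_pair_def by blast
  qed
  from right_kernel_unique[OF t(1) t1 t(2) nc] obtain d where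
    d: "\<And>k. t k + t (k + 1) = d" "\<And>k. t' k + t' (k - 1) = d"
    unfolding const_pair_def by blast
  have "t (k + 1) = t k + d" "t' (k + 1) = t' k + d" for k
    using bit_add_eqD[OF d(1)[of k]] iffD1[OF bit_add_eq_iff d(2)[of "k + 1"]] by simp_all
  note a = bit_affine[of t, OF this(1)] bit_affine[of t', OF this(2)]
  have "(\<lambda>k. t 0 + d * of_int k) = t" "(\<lambda>k. t' 0 + d * of_int k) = t'"
    by (rule ext, rule a[symmetric])+
  then have "right_kernel (\<lambda>k. t 0 + d * of_int k) (\<lambda>k. t' 0 + d * of_int k)"
    using t(1) by (simp only:)
  moreover have "t 0 \<noteq> t' 0" if "d = 0"
  proof
    assume "t 0 = t' 0"
    with a that have "t k = t 0 \<and> t' k = t 0" for k by (metis add.right_neutral mult_zero_left)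
    with t(2) show False unfolding const_pair_def by blast
  qed
  ultimately show ?thesis by (rule that)
qed

lemma n_gt_1: "n > 1"
proof (rule ccontr)
  assume "\<not> n > 1"
  with n_pos have n: "n = 1" by simp
  \<comment> \<open>Both \<open>a\<close> and \<open>b\<close> give kernel elements, and these do not differ by a constant.\<close>
  have per: "s (k + 2) = s k + 1" "r (k + 2) = r k + 1" for k
    using s_period[of k] r_period[of k] n by simp_all
  define h where "h k = s k + s (k + 1)" for k
  define g where "g k = r k + r (k - 1)" for k
  define w where "w k = s k + r k" for k
  have "h (k + 1) = h k + 1" for k
    using per(1)[of k] by (simp add: h_def algebra_simps)
  then have h: "h k = h 0 + 1 * of_int k" for k by (rule bit_affine)
  have "g (k + 1) = g k + 1" for k
    using per(2)[of "k - 1"] by (simp add: g_def algebra_simps)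
  then have g: "g k = g 0 + 1 * of_int k" for k by (rule bit_affine)
  \<comment> \<open>The increment \<open>v\<close> of \<open>w\<close> is constant because
    \<open>w\<close> has period 2; hence \<open>w\<close> is affine.\<close>
  define v where "v k = w k + w (k + 1)" for k
  have "v (k + 1) = v k + 0" for k
    using per[of k] by (simp add: v_def w_def algebra_simps)
  then have v: "v k = v 0" for k using bit_affine[of v 0 k] by simp
  have "w (k + 1) = w k + v 0" for k
    using bit_add_eqD[OF v[of k, unfolded v_def[of k]]] .
  then have w: "w k = w 0 + v 0 * of_int k" for k by (rule bit_affine)
  have k1: "right_kernel (\<lambda>k. h 0 + 1 * of_int k) (\<lambda>k. g 0 + 1 * of_int k)"
  proof (rule right_kernel_affine)
    show "right_translate (\<lambda>k. s k + (h 0 + 1 * of_int k)) (\<lambda>k. r k + (g 0 + 1 * of_int k))"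
      using right_translate_shift[OF right_translate_self, of 1]
      by (rule right_translate_cong) (simp_all only: h[symmetric] g[symmetric], simp_all add: h_def g_def)
  qed
  have k2: "right_kernel (\<lambda>k. w 0 + v 0 * of_int k) (\<lambda>k. (w 0 + 1) + v 0 * of_int k)"
  proof (rule right_kernel_affine)
    have w1: "w 0 + 1 + v 0 * of_int k = w k + 1" for k
      by (subst w) (simp add: ac_simps)
    show "right_translate (\<lambda>k. s k + (w 0 + v 0 * of_int k)) (\<lambda>k. r k + (w 0 + 1 + v 0 * of_int k))"
      using right_translate_swap[OF right_translate_self, of 0]
      by (rule right_translate_cong) (simp_all only: w1 w[symmetric], simp_all add: w_def ac_simps)
  qed
  have "\<not> const_pair (\<lambda>k. h 0 + 1 * of_int k) (\<lambda>k. g 0 + 1 * of_int k)"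
  proof
    assume "const_pair (\<lambda>k. h 0 + 1 * of_int k) (\<lambda>k. g 0 + 1 * of_int k)"
    then obtain c where "\<And>k. h 0 + 1 * of_int k = c" unfolding const_pair_def by blast
    from this[of 0] this[of 1] show False by simp
  qed
  moreover have "\<not> const_pair (\<lambda>k. w 0 + v 0 * of_int k) (\<lambda>k. (w 0 + 1) + v 0 * of_int k)"
  proof
    assume "const_pair (\<lambda>k. w 0 + v 0 * of_int k) (\<lambda>k. (w 0 + 1) + v 0 * of_int k)"
    then obtain c where "\<And>k. w 0 + v 0 * of_int k = c \<and> (w 0 + 1) + v 0 * of_int k = c"
      unfolding const_pair_def by blast
    from this[of 0] show False by auto
  qed
  ultimately have "const_pair (\<lambda>k. (h 0 + 1 * of_int k) + (w 0 + v 0 * of_int k))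
     (\<lambda>k. (g 0 + 1 * of_int k) + ((w 0 + 1) + v 0 * of_int k))"
    by (rule right_kernel_unique[OF k1 k2])
  then obtain c where c: "\<And>k. (h 0 + 1 * of_int k) + (w 0 + v 0 * of_int k) = c"
     "\<And>k. (g 0 + 1 * of_int k) + ((w 0 + 1) + v 0 * of_int k) = c"
    unfolding const_pair_def by blast
  \<comment> \<open>The supposedly constant sum is compared at the group elements \<open>a^0\<close>
    and \<open>a b\<close>, where its values differ by 1.\<close>
  have "g 1 + w 1 + 1 = h 0 + w 0"
    using c(1)[of 0] c(2)[of 1] by (subst g, subst w) (simp add: ac_simps)
  then show False
    unfolding h_def w_def g_def by (simp add: ac_simps)
qed

text \<open>In \<open>r k + r (k + m)\<close> the affine terms leave only \<open>d m = 0\<close>.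
  The \<open>r\<close> half of the autocorrelation is therefore a shifted copy of the
  \<open>s\<close> half, and each half vanishes.\<close>

lemma s_autocorrelation:
  assumes rs: "\<And>k. r k = s (k - p) + (c + d * of_int k)" and "\<not> 2 * int n dvd m"
    and dm: "d * of_int m = 0"
  shows "(\<Sum>i<2 * n. sg (s (int i) + s (int i + m))) = 0"
proof -
  define h where "h k = sg (s k + s (k + m))" for k
  have per: "h (k + int (2 * n)) = h k" for k
    using s_period[of k] s_period[of "k + m"] by (simp add: h_def algebra_simps)
  have "r k + r (k + m) = s (k - p) + s (k - p + m)" for k
    using dm by (simp add: rs algebra_simps)
  then have "sg (r k + r (k + m)) = h (k + (- p))" for k
    by (simp add: h_def)
  then have "(\<Sum>i<2 * n. h (int i)) + (\<Sum>i<2 * n. h (int i + (- p))) = 0"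
    using orth[OF assms(2)] by (simp add: h_def sum.distrib)
  then show ?thesis
    unfolding sum_periodic_shift[of h, OF per] by (simp add: h_def)
qed

lemma not_dvd_small: "0 < m \<Longrightarrow> m < 2 * int n \<Longrightarrow> \<not> 2 * int n dvd m"
  by (auto dest: zdvd_imp_le)

text \<open>Adding the affine kernel element turns the base pair into a right translate. A translate
  by a power of \<open>a\<close> is refuted by divisibility and parity; a translate by
  \<open>a^p b\<close> expresses \<open>r\<close> through \<open>s\<close>, and the autocorrelations
  at shifts 2 and 1 then give the parity of \<open>n\<close> and the slope.\<close>

lemma r_shift_of_s:
  obtains p c c0 c' where "even n" "\<And>k. r k = s (k - p) + (c + of_int k)"
    "right_kernel (\<lambda>k. c0 + of_int k) (\<lambda>k. c' + of_int k)"
proof -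
  obtain c c' d where ker: "right_kernel (\<lambda>k. c + d * of_int k) (\<lambda>k. c' + d * of_int k)"
    and nc: "d = 0 \<Longrightarrow> c \<noteq> c'"
    by (rule right_kernel_affine_ex) blast
  then have "right_translate (\<lambda>k. s k + (c + d * of_int k)) (\<lambda>k. r k + (c' + d * of_int k))"
    using right_translate_self unfolding right_kernel_def by blast
  then obtain p where p: "(\<forall>k. s k + (c + d * of_int k) = s (k + p) \<and> r k + (c' + d * of_int k) = r (k - p))
      \<or> (\<forall>k. s k + (c + d * of_int k) = r (k + p) \<and> r k + (c' + d * of_int k) = s (k - p) + 1)"
    unfolding right_translate_def by blast
  have m1: "\<not> 2 * int n dvd 1" and m2: "\<not> 2 * int n dvd 2"
    using n_gt_1 by (auto intro!: not_dvd_small)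
  from p show ?thesis
  proof
    assume "\<forall>k. s k + (c + d * of_int k) = s (k + p) \<and> r k + (c' + d * of_int k) = r (k - p)"
    then have ps: "\<And>k. s (k + p) = s k + (c + d * of_int k)" and pr: "\<And>k. r (k - p) = r k + (c' + d * of_int k)"
      by auto
    \<comment> \<open>Translating twice cancels the affine terms up to the constant
      \<open>d p\<close>, so \<open>shift_invariant_dvd\<close> applies to
      \<open>2 p\<close>.\<close>
    have s2: "s (k + 2 * p) = s k + d * of_int p" for k
      using ps[of "k + p"] ps[of k] by (simp add: algebra_simps)
    have r2: "r (k + 2 * p) = r k + d * of_int p" for k
      using pr[of "k + p"] pr[of "k + 2 * p"] by (simp add: algebra_simps)
    have "2 * int n dvd 2 * p"
      using s2 r2 by (rule shift_invariant_dvd)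
    then obtain q where q: "p = int n * q" by auto
    show ?thesis
    proof (cases "even q")
      case True
      then obtain q' where "p = 2 * int n * q'" using q by auto
      then have a: "c + d * of_int k = of_int q'" "c' + d * of_int k = of_int q'" for k
        using ps[of k] pr[of k] s_period_mult[of k q'] r_period_mult[of k "- q'"] by simp_all
      have "d = 0" using a(1)[of 0] a(1)[of 1] by simp
      with nc a[of 0] show ?thesis by simp
    next
      case False
      have "s (2 * p) = s 0 + of_int q"
        using s_period_mult[of 0 q] q by (simp add: ac_simps)
      with s2[of 0] False have dp: "d * of_int p = 1" by (simp add: of_int_bit)
      then have d: "d = 1" and "odd p" by (auto simp: of_int_bit split: if_splits)
      with q have n: "odd n" by simp
      from False obtain q' where q': "q = 2 * q' + 1" by (elim oddE)
      have sn: "s (k + int n) = s k + (c + of_int q' + of_int k)" for k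
        using s_period_mult[of "k + int n" q'] ps[of k] q q' d
        by (simp add: algebra_simps bit_add_eq_iff)
      have rn: "r (k + int n) = r k + (c' + 1 + of_int q' + of_int k)" for k
        using r_period_mult[of "k - p" "q' + 1"] pr[of k] q q' d
        by (simp add: algebra_simps bit_add_eq_iff)
      \<comment> \<open>The shift by \<open>n\<close> adds affine terms, which cancel between
        arguments at distance 2. So \<open>h\<close> has period \<open>n\<close>, and its sum over a
        single period already vanishes.\<close>
      define h where "h k = sg (s k + s (k + 2)) + sg (r k + r (k + 2))" for k
      have hp: "h (k + int n) = h k" for k
        using sn[of k] sn[of "k + 2"] rn[of k] rn[of "k + 2"]
        by (simp add: h_def algebra_simps)
      have "(\<Sum>i<2 * n. h (int i)) = 0"
        using orth[OF m2] by (simp add: h_def)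
      also have "{..<2 * n} = {..<n} \<union> {n..<n + n}" by auto
      also have "(\<Sum>i\<in>{..<n} \<union> {n..<n + n}. h (int i)) = (\<Sum>i<n. h (int i)) + (\<Sum>i=n..<n + n. h (int i))"
        by (rule sum.union_disjoint) auto
      also have "(\<Sum>i=n..<n + n. h (int i)) = (\<Sum>i<n. h (int i))"
        using sum.shift_bounds_nat_ivl[of "\<lambda>i. h (int i)" 0 n n] hp
        by (simp add: atLeast0LessThan)
      finally have "(\<Sum>i<n. h (int i)) = 0" by simp
      then have "(\<Sum>(i, e)\<in>{..<n} \<times> (UNIV::bool set).
          sg (if e then s (int i) + s (int i + 2) else r (int i) + r (int i + 2))) = 0"
        by (simp add: h_def sum.cartesian_product[symmetric] UNIV_bool add.commute)
      then have "(\<Sum>x\<in>{..<n} \<times> (UNIV::bool set).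
          sg (case x of (i, e) \<Rightarrow> if e then s (int i) + s (int i + 2) else r (int i) + r (int i + 2))) = 0"
        by (simp add: case_prod_unfold)
      then have "(\<Sum>x\<in>{..<n} \<times> (UNIV::bool set).
          (case x of (i, e) \<Rightarrow> if e then s (int i) + s (int i + 2) else r (int i) + r (int i + 2))) = of_nat n"
        by (rule balanced_sum_bit[rotated]) (simp_all add: card_cartesian_product)
      then have "(\<Sum>i<n. s (int i) + s (int i + 2)) + (\<Sum>i<n. r (int i) + r (int i + 2)) = of_nat n"
        by (simp add: sum.cartesian_product[symmetric] UNIV_bool sum.distrib ac_simps)
      \<comment> \<open>Each of the two telescoping sums is 1, so their total is 0, whereas
        \<open>n\<close> is odd.\<close>
      then have "of_nat n = (0::bit)"
        using sn[of 0] sn[of 1] rn[of 0] rn[of 1] unfolding sum_bit_shift2_diff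
        by (simp add: algebra_simps)
      with n show ?thesis by (simp add: of_nat_bit)
    qed
  next
    assume "\<forall>k. s k + (c + d * of_int k) = r (k + p) \<and> r k + (c' + d * of_int k) = s (k - p) + 1"
    then have rp: "r (k + p) = s k + (c + d * of_int k)" for k by simp
    have rs: "r k = s (k - p) + ((c + d * of_int p) + d * of_int k)" for k
      using rp[of "k - p"] by (simp add: algebra_simps)
    note ac = s_autocorrelation[OF rs]
    \<comment> \<open>At shift 2 the telescoping sum is 0, since \<open>s 0\<close> and
      \<open>s 1\<close> are both complemented over the length \<open>2 n\<close>.\<close>
    have even_n: "even n"
    proof -
      have "(\<Sum>i<2 * n. s (int i) + s (int i + 2)) = of_nat n"
        using ac[OF m2] by (intro balanced_sum_bit) simp_all
      then have "of_nat n = (0::bit)"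
        using s_period[of 0] s_period[of 1] unfolding sum_bit_shift2_diff
        by (simp add: ac_simps)
      then show ?thesis by (simp add: of_nat_bit split: if_splits)
    qed
    \<comment> \<open>With slope 0 the autocorrelation at shift 1 would vanish too, and there
      telescoping gives 1, making \<open>n\<close> odd.\<close>
    have "d = 1"
    proof (rule ccontr)
      assume "d \<noteq> 1"
      then have "(\<Sum>i<2 * n. s (int i) + s (int i + 1)) = of_nat n"
        using ac[OF m1] by (intro balanced_sum_bit) simp_all
      then have "of_nat n = (1::bit)"
        using s_period[of 0] unfolding sum_bit_shift_diff
        by (simp add: ac_simps)
      with even_n show False by (simp add: of_nat_bit)
    qed
    with even_n rs ker that show ?thesis by simp
  qed
qed

lemma n_gt_2:
  assumes rs: "\<And>k. r k = s (k - p) + (c + of_int k)"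
    and ker: "right_kernel (\<lambda>k. c0 + of_int k) (\<lambda>k. c' + of_int k)"
  shows "n > 2"
proof (rule ccontr)
  assume "\<not> n > 2"
  with n_gt_1 have n: "n = 2" by simp
  \<comment> \<open>The element \<open>a\<^sup>2\<close> gives a kernel element \<open>t\<close> that is not affine.\<close>
  have s4: "s (k + 4) = s k + 1" for k
    using s_period[of k] n by simp
  define t where "t k = s k + s (k + 2)" for k
  define t' where "t' k = t (k - p) + 1" for k
  have t2: "t (k + 2) = t k + 1" for k
    using s4[of k] by (simp add: t_def ac_simps)
  have t_even: "t (k + 2 * h) = t k + of_int h" for k h
  proof -
    have "t (k + 2 * (i + 1)) = t (k + 2 * i) + 1" for i
      using t2[of "k + 2 * i"] by (simp add: algebra_simps)
    from bit_affine[of "\<lambda>i. t (k + 2 * i)", OF this] show ?thesis by simp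
  qed
  \<comment> \<open>The sum of four consecutive values is affine because of \<open>s4\<close>; it
    supplies the constant in \<open>base1\<close>.\<close>
  define q where "q k = s k + s (k + 1) + s (k + 2) + s (k + 3)" for k
  have "q (k + 1) = q k + 1" for k
    using s4[of k] by (simp add: q_def algebra_simps)
  then have q: "q k = q 0 + 1 * of_int k" for k by (rule bit_affine)
  have base0: "right_translate (\<lambda>k. s k + t k) (\<lambda>k. r k + t' k)"
  proof -
    have "r k + t' k = r (k - 2)" for k
      using s4[of "k - p - 2"] by (simp add: t'_def t_def rs algebra_simps)
    then show ?thesis
      by (intro right_translate_cong[OF right_translate_shift[OF right_translate_self, of 2]])
         (simp_all add: t_def)
  qed
  have base1: "right_translate (\<lambda>k. s k + t (k + 1)) (\<lambda>k. r k + t' (k - 1))"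
  proof -
    have "s k + t (k + 1) = r (k + (p + 2)) + (q 0 + c + of_int p)" for k
      using q[of k] by (simp add: t_def q_def[of k] rs algebra_simps bit_add_eq_iff)
    moreover have "r k + t' (k - 1) = s (k - (p + 2)) + 1 + (q 0 + c + of_int p)" for k
      using q[of "k - p - 3", unfolded q_def[of "k - p - 3"]] s4[of "k - p - 3"]
      by (simp add: t_def t'_def rs algebra_simps bit_add_eq_iff)
    ultimately show ?thesis
      by (intro right_translate_cong[OF right_translate_const[OF
        right_translate_swap[OF right_translate_self, of "p + 2"], of "q 0 + c + of_int p"]])
  qed
  \<comment> \<open>Shifting \<open>t\<close> by 2 only adds 1, so the cases \<open>base0\<close>
    and \<open>base1\<close> cover all shifts.\<close>
  have base: "right_translate (\<lambda>k. s k + t (k + q)) (\<lambda>k. r k + t' (k - q))" for q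
  proof (cases "even q")
    case True
    then obtain h where h: "q = 2 * h" by blast
    show ?thesis
      by (rule right_translate_cong[OF right_translate_const[OF base0, of "of_int h"]])
         (use t_even[of _ h] t_even[of "k - p" "- h" for k] in \<open>simp_all add: h t'_def algebra_simps\<close>)
  next
    case False
    then obtain h where h: "q = 2 * h + 1" by (elim oddE)
    show ?thesis
      by (rule right_translate_cong[OF right_translate_const[OF base1, of "of_int h"]])
         (use t_even[of "k + 1" h for k] t_even[of "k - p - 1" "- h" for k]
           in \<open>simp_all add: h t'_def algebra_simps\<close>)
  qed
  have "right_kernel t t'"
    unfolding right_kernel_def
  proof (intro allI impI)
    fix x y assume "right_translate x y"
    then obtain q where
      "(\<forall>k. x k = s (k + q) \<and> y k = r (k - q)) \<or> (\<forall>k. x k = r (k + q) \<and> y k = s (k - q) + 1)"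
      unfolding right_translate_def by blast
    then show "right_translate (\<lambda>k. x k + t k) (\<lambda>k. y k + t' k)"
    proof
      assume *: "\<forall>k. x k = s (k + q) \<and> y k = r (k - q)"
      from right_translate_shift[OF base[of "- q"], of q] show ?thesis
        by (rule right_translate_cong) (simp_all add: *)
    next
      assume *: "\<forall>k. x k = r (k + q) \<and> y k = s (k - q) + 1"
      \<comment> \<open>The offset \<open>q - p\<close> compensates the shift by \<open>p\<close> in
        \<open>t'\<close>, so that after the swap the added terms are again \<open>t\<close> and
        \<open>t'\<close>, up to 1.\<close>
      from right_translate_const[OF right_translate_swap[OF base[of "q - p"], of q], of 1]
      show ?thesis
        by (rule right_translate_cong) (simp_all add: * t'_def algebra_simps)
    qed
  qed
  moreover note ker
  moreover have "\<not> const_pair t t'"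
  proof
    assume "const_pair t t'"
    then obtain e where "\<And>k. t k = e" unfolding const_pair_def by blast
    with t2[of 0] show False by simp
  qed
  moreover have "\<not> const_pair (\<lambda>k. c0 + of_int k) (\<lambda>k. c' + of_int k)"
  proof
    assume "const_pair (\<lambda>k. c0 + of_int k) (\<lambda>k. c' + of_int k)"
    then obtain e where "\<And>k. c0 + of_int k = e" unfolding const_pair_def by blast
    from this[of 0] this[of 1] show False by simp
  qed
  ultimately have "const_pair (\<lambda>k. t k + (c0 + of_int k)) (\<lambda>k. t' k + (c' + of_int k))"
    by (rule right_kernel_unique)
  then obtain e where "\<And>k. t k + (c0 + of_int k) = e" unfolding const_pair_def by blast
  \<comment> \<open>From 0 to 2 the affine term keeps its value while \<open>t\<close>
    changes.\<close>
  from this[of 0] this[of 2] t2[of 0] show False by (auto simp: ac_simps)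
qed

end

section \<open>Structure of the left kernel\<close>

context orthogonal_negaperiodic_pair
begin

lemma left_kernel_const: "left_kernel (\<lambda>k. c) (\<lambda>k. c)"
  using left_translate_const by (simp add: left_kernel_def)

text \<open>Expresses that \<open>a^w\<close> belongs to the left kernel, viewed as the difference
  of the base pair and its translate. These exponents form a subgroup of the integers.\<close>

definition left_period :: "int \<Rightarrow> bool" where
  "left_period w \<longleftrightarrow> left_kernel (\<lambda>k. s k + s (k + w)) (\<lambda>k. r k + r (k + w))"

lemma left_period_add: "left_period (v + w)" if "left_period v" "left_period w"
  using left_kernel_add[OF that(1)[unfolded left_period_def]
      left_kernel_shift[OF that(2)[unfolded left_period_def], of v]]
  unfolding left_period_def
  by (rule left_kernel_cong) (simp_all add: algebra_simps)

lemma left_period_minus: "left_period (- w)" if "left_period w"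
  using left_kernel_shift[OF that[unfolded left_period_def], of "- w"]
  unfolding left_period_def
  by (rule left_kernel_cong) (simp_all add: algebra_simps)

lemma left_period_mult: "left_period (q * w)" if "left_period w"
proof (induction q rule: int_induct[where k = 0])
  case base
  show ?case by (simp add: left_period_def left_kernel_zero)
next
  case (step1 i)
  from left_period_add[OF step1(2) that] show ?case by (simp add: algebra_simps)
next
  case (step2 i)
  from left_period_add[OF step2(2) left_period_minus[OF that]] show ?case by (simp add: algebra_simps)
qed

text \<open>The left periods contain \<open>w\<close> and \<open>2 n\<close>, hence their gcd
  \<open>c\<close>. Write \<open>2 n = c M\<close>: for even \<open>M\<close>, \<open>n\<close> is a
  multiple of \<open>c\<close>; odd \<open>M\<close> turns out to be 1, contrary to
  \<open>ndvd\<close>.\<close>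

lemma left_period_half:
  assumes w: "left_period w" and ndvd: "\<not> 2 * int n dvd w"
  shows "left_period (int n)"
proof -
  define c where "c = gcd w (2 * int n)"
  have "left_period (2 * int n)"
    using left_kernel_const[of 1] unfolding left_period_def
    by (rule left_kernel_cong) (simp_all add: s_period r_period)
  moreover obtain x y where "x * w + y * (2 * int n) = c"
    unfolding c_def using bezout_int by blast
  ultimately have pc: "left_period c"
    using left_period_add[OF left_period_mult left_period_mult] w by metis
  have c_pos: "c > 0" using n_pos by (simp add: c_def)
  obtain M' where M': "2 * int n = c * M'" unfolding c_def by (meson gcd_dvd2 dvdE)
  then have "M' > 0" using c_pos n_pos by (metis of_nat_0_less_iff zero_less_mult_pos mult_pos_pos zero_less_numeral)
  then obtain M where M: "M' = int M" "M > 0" by (metis zero_less_imp_eq_int)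
  show ?thesis
  proof (cases "even M")
    case True
    then obtain h where "M = 2 * h" by blast
    with M' M have "int n = int h * c" by simp
    with left_period_mult[OF pc] show ?thesis by metis
  next
    case False
    \<comment> \<open>Averaging over the subgroup generated by \<open>a\<^bsup>2c\<^esup>\<close>, which has the odd order \<open>M\<close>, gives a left
      translate of the pair that is invariant under this subgroup.\<close>
    define S R where "S k = (\<Sum>i<M. s (k + 2 * c * int i))" and "R k = (\<Sum>i<M. r (k + 2 * c * int i))" for k
    have "left_kernel (\<lambda>k. \<Sum>i<M. s k + s (k + 2 * c * int i)) (\<lambda>k. \<Sum>i<M. r k + r (k + 2 * c * int i))"
    proof (rule left_kernel_sum)
      fix i
      show "left_kernel (\<lambda>k. s k + s (k + 2 * c * int i)) (\<lambda>k. r k + r (k + 2 * c * int i))"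
        using left_period_mult[OF pc, of "2 * int i"] unfolding left_period_def
        by (rule left_kernel_cong) (simp_all add: ac_simps)
    qed simp
    from left_kernelD[OF this left_translate_self]
    have "left_translate S R"
      \<comment> \<open>Since \<open>M\<close> is odd, the \<open>M + 1\<close> copies of
        \<open>s\<close> and of \<open>r\<close> cancel, leaving \<open>S\<close> and
        \<open>R\<close>.\<close>
      by (rule left_translate_cong) (use False in \<open>simp_all add: S_def R_def sum.distrib of_nat_bit\<close>)
    then obtain q where q: "(\<forall>k. S k = s (k + q) \<and> R k = r (k + q)) \<or> (\<forall>k. S k = r (q - k) \<and> R k = s (q - k) + 1)"
      unfolding left_translate_def by blast
    have per: "2 * c * (i + int M) = 2 * c * i + 2 * int n * 2" for i
      using M' M by (simp add: algebra_simps)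
    have S: "S (k + 2 * c) = S k" for k
    proof -
      have "s (k + 2 * c * (i + int M)) = s (k + 2 * c * i)" for i
        using s_period_mult[of "k + 2 * c * i" 2] per[of i] by (simp add: ac_simps)
      from sum_periodic_shift[of "\<lambda>i. s (k + 2 * c * i)", OF this, of 1]
      show ?thesis by (simp add: S_def algebra_simps)
    qed
    have R: "R (k + 2 * c) = R k" for k
    proof -
      have "r (k + 2 * c * (i + int M)) = r (k + 2 * c * i)" for i
        using r_period_mult[of "k + 2 * c * i" 2] per[of i] by (simp add: ac_simps)
      from sum_periodic_shift[of "\<lambda>i. r (k + 2 * c * i)", OF this, of 1]
      show ?thesis by (simp add: R_def algebra_simps)
    qed
    \<comment> \<open>Both forms of the translate carry the invariance under \<open>2 c\<close> from
      \<open>S\<close> and \<open>R\<close> back to \<open>s\<close> and \<open>r\<close>, so the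
      odd number \<open>M\<close> divides 2.\<close>
    from q have "(\<forall>k. s (k + 2 * c) = s k + 0 \<and> r (k + 2 * c) = r k + 0)"
    proof
      assume *: "\<forall>k. S k = s (k + q) \<and> R k = r (k + q)"
      show ?thesis
      proof
        fix k
        show "s (k + 2 * c) = s k + 0 \<and> r (k + 2 * c) = r k + 0"
          using S[of "k - q"] R[of "k - q"] * by (simp add: algebra_simps)
      qed
    next
      assume *: "\<forall>k. S k = r (q - k) \<and> R k = s (q - k) + 1"
      show ?thesis
      proof
        fix k
        show "s (k + 2 * c) = s k + 0 \<and> r (k + 2 * c) = r k + 0"
          using S[of "q - k - 2 * c"] R[of "q - k - 2 * c"] * by (simp add: algebra_simps)
      qed
    qed
    then have "2 * int n dvd 2 * c"
      using shift_invariant_dvd by blast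
    then have "c * int M dvd c * 2"
      unfolding M' M(1) by (simp only: mult.commute)
    then have "int M dvd 2" using c_pos by simp
    then have "M dvd 2" by presburger
    then have "M \<le> 2" by (auto dest: dvd_imp_le)
    then have "M = 1" using False M(2) by (cases "M = 2") auto
    with M' M have "2 * int n = c" by simp
    with ndvd show ?thesis unfolding c_def by (metis gcd_dvd1)
  qed
qed

text \<open>If a nontrivial \<open>a^w\<close> lies in the kernel, so does \<open>a^n\<close>, and
  summing \<open>n\<close> translates gives slope 1. Otherwise every nonconstant kernel element
  comes from some \<open>a^w b\<close>, and comparison with its own shift by 1 gives a constant
  increment.\<close>

lemma left_kernel_affine_ex:
  assumes ker: "left_kernel t t'" and nc: "\<not> const_pair t t'"
  obtains t t' d where "left_kernel t t'" "\<not> const_pair t t'" "\<And>k. t (k + 1) = t k + d"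
proof (cases "\<exists>w. left_period w \<and> \<not> 2 * int n dvd w")
  case True
  then have "left_period (int n)" using left_period_half by blast
  define t t' where "t k = s k + s (k + int n)" and "t' k = r k + r (k + int n)" for k
  have "left_kernel t t'"
    using \<open>left_period (int n)\<close> unfolding left_period_def t_def t'_def .
  \<comment> \<open>The sum telescopes:
    \<open>v k + v (k + 1) = t k + t (k + n) = s k + s (k + 2 n) = 1\<close>.\<close>
  define v v' where "v k = (\<Sum>i<n. t (k + int i))" and "v' k = (\<Sum>i<n. t' (k + int i))" for k
  have "left_kernel v v'"
    unfolding v_def v'_def by (intro left_kernel_sum left_kernel_shift \<open>left_kernel t t'\<close>) simp
  moreover have v: "v (k + 1) = v k + 1" for k
  proof -
    have "v k + v (k + 1) = (\<Sum>i<n. t (k + int i) + t (k + (int i + 1)))"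
      by (simp add: v_def sum.distrib ac_simps)
    also have "\<dots> = t k + t (k + int n)"
      by (subst sum_bit_shift_diff[of "\<lambda>i. t (k + i)"]) simp
    also have "\<dots> = 1"
      using s_period[of k] by (simp add: t_def ac_simps)
    finally show ?thesis by (rule bit_add_eqD)
  qed
  moreover have "\<not> const_pair v v'"
  proof
    assume "const_pair v v'"
    then obtain e where "\<And>k. v k = e" unfolding const_pair_def by blast
    with v[of 0] show False by simp
  qed
  ultimately show ?thesis using that by blast
next
  case False
  have shape: "\<exists>w. \<forall>k. t k = s k + r (w - k) \<and> t' k = r k + s (w - k) + 1"
    if k: "left_kernel t t'" "\<not> const_pair t t'" for t t'
  proof -
    obtain w where "(\<forall>k. s k + t k = s (k + w) \<and> r k + t' k = r (k + w)) \<or>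
        (\<forall>k. s k + t k = r (w - k) \<and> r k + t' k = s (w - k) + 1)"
      using left_kernelD[OF k(1) left_translate_self] unfolding left_translate_def by blast
    then show ?thesis
    proof
      assume *: "\<forall>k. s k + t k = s (k + w) \<and> r k + t' k = r (k + w)"
      then have t: "t k = s k + s (k + w)" "t' k = r k + r (k + w)" for k
        using bit_add_eqD[of "s k" "t k"] bit_add_eqD[of "r k" "t' k"] by simp_all
      then have "left_period w"
        unfolding left_period_def by (intro left_kernel_cong[OF k(1)]) simp_all
      with False obtain q where "w = 2 * int n * q" by auto
      then have "t k = of_int q \<and> t' k = of_int q" for k
        using t s_period_mult r_period_mult by simp
      with k(2) show ?thesis unfolding const_pair_def by blast
    next
      assume *: "\<forall>k. s k + t k = r (w - k) \<and> r k + t' k = s (w - k) + 1"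
      then have "t k = s k + r (w - k) \<and> t' k = r k + s (w - k) + 1" for k
        using bit_add_eqD[of "s k" "t k"] bit_add_eqD[of "r k" "t' k"] by (simp add: ac_simps)
      then show ?thesis by blast
    qed
  qed
  obtain w1 where w1: "\<And>k. t k = s k + r (w1 - k)" "\<And>k. t' k = r k + s (w1 - k) + 1"
    using shape[OF ker nc] by blast
  have ker1: "left_kernel (\<lambda>k. t (k + 1)) (\<lambda>k. t' (k + 1))"
    using ker by (rule left_kernel_shift)
  have nc1: "\<not> const_pair (\<lambda>k. t (k + 1)) (\<lambda>k. t' (k + 1))"
  proof
    assume "const_pair (\<lambda>k. t (k + 1)) (\<lambda>k. t' (k + 1))"
    then obtain e where e: "\<And>k. t (k + 1) = e \<and> t' (k + 1) = e" unfolding const_pair_def by blast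
    have "t k = e \<and> t' k = e" for k using e[of "k - 1"] by simp
    with nc show False unfolding const_pair_def by blast
  qed
  obtain w2 where w2: "\<And>k. t (k + 1) = s k + r (w2 - k)" "\<And>k. t' (k + 1) = r k + s (w2 - k) + 1"
    using shape[OF ker1 nc1] by blast
  \<comment> \<open>The reflections with parameters \<open>w1\<close> and \<open>w2\<close> compose
    to the translation by \<open>w1 - w2\<close>, which must be trivial in this case.\<close>
  have "left_period (w1 - w2)"
    using left_kernel_add[OF left_kernel_const[of 1] left_kernel_add[OF ker1 left_kernel_swap[OF ker, of w2]]]
    unfolding left_period_def
    by (rule left_kernel_cong) (simp_all add: w2, simp_all add: w1 algebra_simps)
  with False obtain q where "w1 - w2 = 2 * int n * q" by auto
  then have "w1 = w2 + 2 * int n * q" by simp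
  then have "t (k + 1) = t k + of_int q" for k
    using r_period_mult[of "w2 - k" q] unfolding w2 w1[of k] by (simp add: algebra_simps)
  with that ker nc show ?thesis by blast
qed

end

section \<open>Triviality of the left kernel\<close>

context small_kernel_pair
begin

theorem left_kernel_trivial:
  assumes "left_kernel t0 t0'" shows "const_pair t0 t0'"
proof (rule ccontr)
  assume "\<not> const_pair t0 t0'"
  with assms obtain t t' d where ker: "left_kernel t t'" and nc: "\<not> const_pair t t'"
    and t1: "\<And>k. t (k + 1) = t k + d"
    by (rule left_kernel_affine_ex) blast
  obtain p c c0 c' where even_n: "even n" and rs: "\<And>k. r k = s (k - p) + (c + of_int k)"
    and rker: "right_kernel (\<lambda>k. c0 + of_int k) (\<lambda>k. c' + of_int k)"
    using r_shift_of_s by blast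
  note n2 = n_gt_2[OF rs rker]
  have t: "t k = t 0 + d * of_int k" for k
    using t1 by (rule bit_affine)
  obtain w where "(\<forall>k. s k + t k = s (k + w) \<and> r k + t' k = r (k + w)) \<or>
      (\<forall>k. s k + t k = r (w - k) \<and> r k + t' k = s (w - k) + 1)"
    using left_kernelD[OF ker left_translate_self] unfolding left_translate_def by blast
  then show False
  proof
    \<comment> \<open>Translation by \<open>a^w\<close>: again \<open>2 w\<close> is a multiple of
      \<open>2 n\<close>, and since \<open>n\<close> is even, \<open>w\<close> is a multiple of
      \<open>2 n\<close> itself, which makes the element constant.\<close>
    assume *: "\<forall>k. s k + t k = s (k + w) \<and> r k + t' k = r (k + w)"
    have sw: "s (k + w) = s k + (t 0 + d * of_int k)" for k
      using * t[of k] by metis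
    have s2: "s (k + 2 * w) = s k + d * of_int w" for k
      using sw[of k] sw[of "k + w"] by (simp add: algebra_simps)
    have r2: "r (k + 2 * w) = r k + d * of_int w" for k
      using s2[of "k - p"] by (simp add: rs algebra_simps)
    have "2 * int n dvd 2 * w"
      using s2 r2 by (rule shift_invariant_dvd)
    then obtain q where q: "w = int n * q" by auto
    with even_n have "even w" by simp
    then have "s (2 * w) = s 0" using s2[of 0] by (simp add: of_int_bit)
    moreover have "s (2 * w) = s 0 + of_int q"
      using s_period_mult[of 0 q] q by (simp add: ac_simps)
    ultimately have "even q" by (auto simp: of_int_bit split: if_splits)
    then obtain q' where "w = 2 * int n * q'" using q by auto
    then have "t k = of_int q' \<and> t' k = of_int q'" for k
      using spec[OF *, of k] s_period_mult[of k q'] r_period_mult[of k q'] by simp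
    with nc show False unfolding const_pair_def by blast
  next
    assume *: "\<forall>k. s k + t k = r (w - k) \<and> r k + t' k = s (w - k) + 1"
    \<comment> \<open>Inserting the formula for \<open>r\<close> turns the relation between
      \<open>s\<close> and \<open>r\<close> into a reflection of \<open>s\<close> about
      \<open>j / 2\<close>.\<close>
    define j where "j = w - p"
    define e where "e = t 0 + c + of_int w"
    have refl: "s (j - k) = s k + ((1 + d) * of_int k + e)" for k
    proof -
      have "s (j - k) = r (w - k) + (c + of_int (w - k))"
        by (simp add: rs j_def algebra_simps)
      also have "r (w - k) = s k + (t 0 + d * of_int k)"
        using * t[of k] by metis
      finally show ?thesis by (simp add: e_def algebra_simps)
    qed
    \<comment> \<open>Reflecting 0 to \<open>j\<close> and back to 0 must add nothing.\<close>
    have dj: "(1 + d) * of_int j = 0"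
      using refl[of 0] refl[of j] by (simp add: algebra_simps)
    show False
    proof (cases "even j")
      case True
      then obtain h where h: "j = 2 * h" by blast
      \<comment> \<open>The reflection fixes \<open>h\<close> but sends \<open>h + n\<close> to
        \<open>h - n\<close>, where \<open>s\<close> has the complementary value. For even
        \<open>n\<close> the affine term is the same at \<open>h\<close> and
        \<open>h + n\<close>.\<close>
      have "(1 + d) * of_int h + e = 0"
        using refl[of h] by (simp add: h)
      moreover have "(1 + d) * of_int (h + int n) + e = 1"
      proof -
        define X where "X = (1 + d) * of_int (h + int n) + e"
        have "s (h - int n) = s (h + int n) + X"
          using refl[of "h + int n"] by (simp add: h X_def)
        moreover have "s (h + int n) = s (h - int n) + 1"
          using s_period[of "h - int n"] by (simp add: algebra_simps)
        ultimately have "X = 1"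
          by (cases "X = 0") simp_all
        then show ?thesis by (simp only: X_def)
      qed
      ultimately show False
        using even_n by (simp add: of_nat_bit)
    next
      case False
      with dj have "d = 1" by (cases "d = 0") (simp_all add: of_int_bit)
      then have sj: "s (j - k) = s k + e" for k using refl[of k] by simp
      \<comment> \<open>Reflection with odd \<open>j\<close> exchanges even and odd indices, so at
        even shifts the autocorrelation of \<open>s\<close> splits into two equal halves, each of
        which vanishes.\<close>
      have half: "(\<Sum>i<n. sg (s (2 * int i) + s (2 * int i + m))) = 0"
        if m: "even m" "\<not> 2 * int n dvd m" for m
      proof -
        define h where "h k = sg (s k + s (k + m))" for k
        have hp: "h (k + int (2 * n)) = h k" for k
          using s_period[of k] s_period[of "k + m"] by (simp add: h_def algebra_simps)
        have hr: "h (j - m - k) = h k" for k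
          using sj[of k] sj[of "k + m"] by (simp add: h_def algebra_simps)
        define g where "g i = h (2 * i)" for i
        have gp: "g (i + int n) = g i" for i
          using hp[of "2 * i"] by (simp add: g_def algebra_simps)
        have "even (j - m - 1)" using False m(1) by simp
        then obtain l where l: "j - m - 1 = 2 * l" by (elim evenE)
        have "(\<Sum>i<2 * n. h (int i)) = 0"
          using s_autocorrelation[of p c 1 m] rs m by (simp add: h_def of_int_bit)
        also have "(\<Sum>i<2 * n. h (int i)) = (\<Sum>i<n. g (int i)) + (\<Sum>i<n. h (2 * int i + 1))"
          by (induction n) (simp_all add: g_def algebra_simps)
        also have "(\<Sum>i<n. h (2 * int i + 1)) = (\<Sum>i<n. g (l - int i))"
        proof (rule sum.cong)
          fix i
          have "h (2 * int i + 1) = h (j - m - (2 * int i + 1))" by (simp only: hr)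
          also have "j - m - (2 * int i + 1) = 2 * (l - int i)" using l by simp
          finally show "h (2 * int i + 1) = g (l - int i)" by (simp add: g_def)
        qed simp
        also have "\<dots> = (\<Sum>i<n. g (int i))"
          using gp by (rule sum_periodic_reflect)
        finally show ?thesis by (simp add: g_def h_def)
      qed
      obtain N where N: "n = 2 * N" using even_n by blast
      \<comment> \<open>These are the shifts 1 and 2 of the even-indexed subsequence;
        \<open>n > 2\<close> ensures \<open>4 < 2 n\<close>.\<close>
      have "\<not> 2 * int n dvd 2" "\<not> 2 * int n dvd 4"
        using n2 not_dvd_small[of 2] not_dvd_small[of 4] by simp_all
      then have b: "(\<Sum>i<n. s (2 * int i) + s (2 * int i + 2)) = of_nat N"
          "(\<Sum>i<n. s (2 * int i) + s (2 * int i + 4)) = of_nat N"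
        using half[of 2] half[of 4] N by (auto intro!: balanced_sum_bit)
      \<comment> \<open>Telescoping makes \<open>N\<close> odd by the first sum and even by the
        second.\<close>
      have "(\<Sum>i<n. s (2 * int i) + s (2 * int i + 2)) = 1"
        using sum_bit_shift_diff[of "\<lambda>i. s (2 * i)" n] s_period[of 0] by (simp add: algebra_simps)
      moreover have "(\<Sum>i<n. s (2 * int i) + s (2 * int i + 4)) = 0"
        using sum_bit_shift2_diff[of "\<lambda>i. s (2 * i)" n] s_period[of 0] s_period[of 2]
        by (simp add: algebra_simps)
      ultimately show False using b by simp
    qed
  qed
qed

end

section \<open>Hadamard codes and kernels\<close>

lemma bit_vec_add_self [simp]: "x + x = (0 :: bit ^ 'm)"
  by (simp add: vec_eq_iff)

lemma bit_vec_add_self_left [simp]: "x + (x + y) = (y :: bit ^ 'm)"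
  by (simp flip: add.assoc)

lemma bit_vec_add_self_right [simp]: "x + y + y = (x :: bit ^ 'm)"
  by (simp add: add.assoc)

lemma span_one_bit: "vec.span {1 :: bit ^ 'm} = {0, 1}"
proof -
  have "k *s (1 :: bit ^ 'm) \<in> {0, 1}" for k
    by (cases "k = 0") auto
  moreover have "0 = 0 *s (1 :: bit ^ 'm)" "1 = 1 *s (1 :: bit ^ 'm)"
    by simp_all
  ultimately show ?thesis
    unfolding vec.span_singleton by blast
qed

lemma independent_one_bit: "vec.independent {1 :: bit ^ 'm}"
  by (simp add: vec.dependent_single)

lemma dim_zero_one_bit: "vec.dim {0, 1 :: bit ^ 'm} = 1"
  using vec.dim_span[of "{1 :: bit ^ 'm}"] vec.dim_eq_card_independent[OF independent_one_bit]
  by (simp add: span_one_bit)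

text \<open>Two nontrivial elements with nontrivial sum would form an independent triple with the
  all-one vector. So there is exactly one nontrivial class modulo 1.\<close>

lemma dim_two_bit:
  fixes K :: "(bit ^ 'm) set"
  assumes dim: "vec.dim K = 2" and one: "1 \<in> K"
  shows "\<exists>z\<in>K. z \<notin> {0, 1}"
    and "z1 \<in> K - {0, 1} \<Longrightarrow> z2 \<in> K - {0, 1} \<Longrightarrow> z1 + z2 \<in> {0, 1}"
proof -
  show "\<exists>z\<in>K. z \<notin> {0, 1}"
  proof (rule ccontr)
    assume "\<not> ?thesis"
    then have "K \<subseteq> vec.span {1}" by (auto simp: span_one_bit)
    then have "vec.dim K \<le> 1" using vec.dim_le_card[of K "{1}"] by simp
    with dim show False by simp
  qed
  assume z: "z1 \<in> K - {0, 1}" "z2 \<in> K - {0, 1}"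
  show "z1 + z2 \<in> {0, 1}"
  proof (rule ccontr)
    assume n: "z1 + z2 \<notin> {0, 1}"
    have i1: "vec.independent {z1, 1}"
      using z by (intro vec.independent_insertI independent_one_bit) (auto simp: span_one_bit)
    have "z2 - k *s z1 \<notin> {0, 1}" for k
      using z(2) n by (cases "k = 0") (auto simp: vec_eq_iff add.commute)
    then have "z2 \<notin> vec.span {z1, 1}"
      by (simp add: vec.span_insert[of z1] span_one_bit)
    then have "vec.independent {z2, z1, 1}"
      using i1 by (rule vec.independent_insertI)
    moreover have "z2 \<noteq> z1" using n by auto
    then have "card {z2, z1, 1} = 3"
      using z by simp
    moreover have "{z2, z1, 1} \<subseteq> K" using z one by auto
    ultimately have "3 \<le> vec.dim K" by (metis vec.independent_card_le_dim)
    with dim show False by simp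
  qed
qed

lemma with_complements_add_one: "x \<in> with_complements S \<Longrightarrow> x + 1 \<in> with_complements S"
  by (auto simp: with_complements_def)

lemma code_kernel_add_one_closed:
  assumes "\<And>x. x \<in> S \<Longrightarrow> x + 1 \<in> S" shows "1 \<in> code_kernel S"
proof -
  have "x \<in> (\<lambda>x. x + 1) ` S" if "x \<in> S" for x
    using assms[OF that] by (intro image_eqI[of _ _ "x + 1"]) auto
  then show ?thesis using assms by (auto simp: code_kernel_def)
qed

lemma code_kernel_iff:
  assumes "0 \<in> C"
  shows "z \<in> code_kernel C \<longleftrightarrow> z \<in> C \<and> (\<forall>x\<in>C. x + z \<in> C)"
proof
  assume "z \<in> code_kernel C"
  then have *: "(\<lambda>x. x + z) ` C = C" by (simp add: code_kernel_def)
  with assms have "0 + z \<in> C" by blast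
  with * show "z \<in> C \<and> (\<forall>x\<in>C. x + z \<in> C)" by auto
next
  assume *: "z \<in> C \<and> (\<forall>x\<in>C. x + z \<in> C)"
  have "x \<in> (\<lambda>x. x + z) ` C" if "x \<in> C" for x
    using * that by (intro image_eqI[of _ _ "x + z"]) auto
  with * show "z \<in> code_kernel C" by (auto simp: code_kernel_def)
qed

lemma perm_action_simps:
  "perm_action id v = v" "perm_action p 0 = 0" "perm_action p 1 = 1"
  "perm_action p (x + y) = perm_action p x + perm_action p y"
  by (simp_all add: perm_action_def vec_eq_iff)

lemma perm_action_comp:
  "bij p \<Longrightarrow> bij q \<Longrightarrow> perm_action p (perm_action q v) = perm_action (p \<circ> q) v"
  by (simp add: perm_action_def vec_eq_iff o_inv_distrib)

lemma perm_action_inj: "bij p \<Longrightarrow> perm_action p x = perm_action p y \<Longrightarrow> x = y"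
  unfolding perm_action_def vec_eq_iff
  by (metis (no_types, lifting) bij_inv_eq_iff vec_lambda_beta)

section \<open>Orthogonality and size of Hadamard codes\<close>

context
  fixes M :: "int ^ 'm ^ 'm"
  assumes M: "hadamard_matrix M"
begin

lemma hadamard_entry: "M $ i $ j = sg (binary_matrix_of M $ i $ j)"
  using M by (auto simp: hadamard_matrix_def binary_matrix_of_def)

lemma hadamard_rows_orthogonal:
  assumes "i \<noteq> i'"
  shows "(\<Sum>j\<in>UNIV. sg (row i (binary_matrix_of M) $ j + row i' (binary_matrix_of M) $ j)) = 0"
proof -
  have "(M ** transpose M) $ i $ i' = 0"
    using M assms by (simp add: hadamard_matrix_def mat_def)
  then show ?thesis
    by (simp add: matrix_matrix_mult_def transpose_def row_def sg_add hadamard_entry)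
qed

end

text \<open>Each codeword is a row plus a constant, which affects inner products only by a sign; the
  two inequalities force different rows.\<close>

lemma hadamard_code_orthogonal:
  fixes C :: "(bit ^ 'm) set"
  assumes "binary_hadamard_code C" "x \<in> C" "y \<in> C" "x \<noteq> y" "x \<noteq> y + 1"
  shows "(\<Sum>j\<in>UNIV. sg (x $ j + y $ j)) = 0"
proof -
  obtain M :: "int ^ 'm ^ 'm" where M: "hadamard_matrix M"
    and C: "C = with_complements (rows (binary_matrix_of M))"
    using assms(1) unfolding binary_hadamard_code_def by blast
  let ?r = "\<lambda>i. row i (binary_matrix_of M)"
  have rep: "\<exists>i c. \<forall>j. x $ j = ?r i $ j + c" if "x \<in> C" for x
  proof -
    from that obtain i where "x = ?r i \<or> x = ?r i + 1"
      unfolding C with_complements_def rows_def by blast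
    then show ?thesis
      by (intro exI[of _ i] exI[of _ "if x = ?r i then 0 else 1"]) auto
  qed
  obtain i c i' c' where x: "\<And>j. x $ j = ?r i $ j + c" and y: "\<And>j. y $ j = ?r i' $ j + c'"
    using rep assms(2,3) by metis
  have "i \<noteq> i'"
  proof
    assume "i = i'"
    with x y have "\<forall>j. x $ j = y $ j + (c + c')" by (simp add: ac_simps)
    with assms(4,5) show False
      by (cases "c + c' = 0") (auto simp: vec_eq_iff)
  qed
  have "sg (x $ j + y $ j) = sg (c + c') * sg (?r i $ j + ?r i' $ j)" for j
    by (simp add: x y sg_add)
  then show ?thesis
    using hadamard_rows_orthogonal[OF M \<open>i \<noteq> i'\<close>] by (simp flip: sum_distrib_left)
qed

text \<open>Distinct rows agreeing up to a constant would have inner product plus or minus the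
  length, so all rows and complements are distinct.\<close>

lemma hadamard_code_card:
  fixes C :: "(bit ^ 'm) set"
  assumes "binary_hadamard_code C"
  shows "card C = 2 * CARD('m)"
proof -
  obtain M :: "int ^ 'm ^ 'm" where M: "hadamard_matrix M"
    and C: "C = with_complements (rows (binary_matrix_of M))"
    using assms unfolding binary_hadamard_code_def by blast
  let ?r = "\<lambda>i. row i (binary_matrix_of M)"
  have ne: "?r i $ j \<noteq> ?r i' $ j + c" if "i \<noteq> i'" "\<forall>j. ?r i $ j = ?r i' $ j + c" for i i' j c
  proof -
    have "?r i $ j + ?r i' $ j = c" for j
      using that(2) by (simp add: ac_simps)
    then have "(\<Sum>j\<in>(UNIV::'m set). sg c) = 0"
      using hadamard_rows_orthogonal[OF M that(1)] by simp
    then show ?thesis by (cases "c = 0") auto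
  qed
  have inj: "inj ?r"
  proof (rule injI)
    fix i i' assume "?r i = ?r i'"
    then show "i = i'" using ne[of i i' 0] by (cases "i = i'") auto
  qed
  have disj: "range ?r \<inter> (\<lambda>x. x + 1) ` range ?r = {}"
  proof -
    have "?r i \<noteq> ?r i' + 1" for i i'
    proof
      assume "?r i = ?r i' + 1"
      then have "\<forall>j. ?r i $ j = ?r i' $ j + 1" by (simp add: vec_eq_iff)
      then show False using ne[of i i' 1] by (cases "i = i'") auto
    qed
    then show ?thesis by auto
  qed
  have "rows (binary_matrix_of M) = range ?r" by (auto simp: rows_def)
  moreover have "card ((\<lambda>x. x + 1) ` range ?r) = card (range ?r)"
    by (rule card_image) (auto intro: inj_onI)
  ultimately show ?thesis
    using disj card_image[OF inj] by (simp add: C with_complements_def card_Un_disjoint)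
qed

section \<open>The dicyclic group of a code of type Q\<close>

text \<open>On the finite set \<open>C\<close> left multiplications are injective, hence surjective.
  This gives right inverses, and associativity makes them two-sided.\<close>

lemma group_propelinear:
  assumes "propelinear_code C \<pi>" "\<pi> 0 = id" "finite C"
  shows "group (propelinear_group C \<pi>)"
proof -
  have zero: "0 \<in> C" and bij: "\<And>x. x \<in> C \<Longrightarrow> bij (\<pi> x)"
    and closed: "\<And>x y. x \<in> C \<Longrightarrow> y \<in> C \<Longrightarrow> x + perm_action (\<pi> x) y \<in> C"
    and comp: "\<And>x y. x \<in> C \<Longrightarrow> y \<in> C \<Longrightarrow> \<pi> (x + perm_action (\<pi> x) y) = \<pi> x \<circ> \<pi> y"
    using assms(1) unfolding propelinear_code_def by auto
  let ?m = "\<lambda>x y. x + perm_action (\<pi> x) y"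
  have assoc: "?m (?m x y) z = ?m x (?m y z)" if "x \<in> C" "y \<in> C" "z \<in> C" for x y z
    using that by (simp add: comp perm_action_simps perm_action_comp[OF bij bij] add.assoc)
  have rinv: "\<exists>y\<in>C. ?m x y = 0" if x: "x \<in> C" for x
  proof -
    have "inj_on (?m x) C"
      using perm_action_inj[OF bij[OF x]] by (auto intro: inj_onI)
    then have "?m x ` C = C"
      using closed[OF x] assms(3) by (intro endo_inj_surj) auto
    then show ?thesis using zero by (metis (no_types, lifting) imageE)
  qed
  have linv: "\<exists>y\<in>C. ?m y x = 0" if x: "x \<in> C" for x
  proof -
    obtain y where y: "y \<in> C" "?m x y = 0" using rinv[OF x] by blast
    obtain z where z: "z \<in> C" "?m y z = 0" using rinv[OF y(1)] by blast
    have "x = ?m x (?m y z)" by (simp only: z perm_action_simps) simp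
    also have "\<dots> = ?m (?m x y) z" using assoc[OF x y(1) z(1)] by (simp only:)
    also have "\<dots> = z" by (simp only: y assms(2) perm_action_simps) simp
    finally show ?thesis using y z by blast
  qed
  show ?thesis
    by (rule groupI)
      (use zero closed assoc linv in \<open>simp_all add: propelinear_group_def assms(2) perm_action_simps\<close>)
qed

lemma gword_eval_replicate:
  assumes "group G" "f g \<in> carrier G"
  shows "gword_eval G f (replicate k (g, True)) = f g [^]\<^bsub>G\<^esub> k"
proof -
  interpret group G by fact
  show ?thesis
  proof (induction k)
    case (Suc k)
    then show ?case
      using nat_pow_Suc2[OF assms(2), of k] by (simp add: gword_eval_def)
  qed (simp add: gword_eval_def)
qed

section \<open>The group of the code and its action on coordinates\<close>

locale hfp_type_Q =
  fixes n :: nat and C :: "(bit ^ 'm) set" and \<pi> :: "bit ^ 'm \<Rightarrow> 'm \<Rightarrow> 'm"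
    and a b :: "bit ^ 'm" and base :: 'm
  assumes type_Q: "hfp_code_type_Q n C \<pi> a b"
begin

abbreviation "G \<equiv> propelinear_group C \<pi>"

lemma
  card_index: "CARD('m) = 4 * n" and
  hadamard: "binary_hadamard_code C" and
  propelinear: "propelinear_code C \<pi>" and
  pi_zero: "\<pi> 0 = id" and pi_one: "\<pi> 1 = id" and
  pi_free: "\<And>x i. x \<in> C \<Longrightarrow> \<pi> x i = i \<Longrightarrow> x \<in> {0, 1}" and
  presentation: "has_presentation G (case_gen a b) (type_Q_relations n)"
  using type_Q unfolding hfp_code_type_Q_def hfp_code_def by blast+

lemma
  zero_mem: "0 \<in> C" and
  bij_pi: "\<And>x. x \<in> C \<Longrightarrow> bij (\<pi> x)" and
  pi_comp: "\<And>x y. x \<in> C \<Longrightarrow> y \<in> C \<Longrightarrow> \<pi> (x \<otimes>\<^bsub>G\<^esub> y) = \<pi> x \<circ> \<pi> y"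
  using propelinear unfolding propelinear_code_def propelinear_group_def by auto

lemma n_pos: "n > 0"
  using card_index zero_less_card_finite[where 'a = 'm] by linarith

lemma add_one_mem: "x \<in> C \<Longrightarrow> x + 1 \<in> C"
  using hadamard with_complements_add_one unfolding binary_hadamard_code_def by blast

lemma one_mem: "1 \<in> C"
  using add_one_mem[OF zero_mem] by simp

lemma carrier_G [simp]: "carrier G = C"
  by (simp add: propelinear_group_def)

lemma one_G [simp]: "\<one>\<^bsub>G\<^esub> = 0"
  by (simp add: propelinear_group_def)

lemma mult_G: "x \<otimes>\<^bsub>G\<^esub> y = x + perm_action (\<pi> x) y"
  by (simp add: propelinear_group_def)

lemma finite_C: "finite C"
  using hadamard_code_card[OF hadamard] by (intro card_ge_0_finite) simp

sublocale group G
  using propelinear pi_zero finite_C by (rule group_propelinear)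

lemma mult_mem [simp]: "x \<in> C \<Longrightarrow> y \<in> C \<Longrightarrow> x \<otimes>\<^bsub>G\<^esub> y \<in> C"
  and inv_mem [simp]: "x \<in> C \<Longrightarrow> inv\<^bsub>G\<^esub> x \<in> C"
  and mult_zero [simp]: "x \<in> C \<Longrightarrow> x \<otimes>\<^bsub>G\<^esub> 0 = x"
  and zero_mult [simp]: "x \<in> C \<Longrightarrow> 0 \<otimes>\<^bsub>G\<^esub> x = x"
  using m_closed[of x y] inv_closed[of x] r_one[of x] l_one[of x] by simp_all

lemma mult_one: "x \<otimes>\<^bsub>G\<^esub> 1 = x + 1"
  by (simp add: mult_G perm_action_simps)

text \<open>Codewords serve as labels of coordinates: by \<open>mult_base\<close>, the entry of
  \<open>y\<close> at \<open>pos x\<close> is the difference of the \<open>base\<close> entries of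
  the product of \<open>x\<close> and \<open>y\<close> and of \<open>x\<close>.\<close>

definition pos :: "bit ^ 'm \<Rightarrow> 'm" where
  "pos x = inv_into UNIV (\<pi> x) base"

lemma mult_base: "(x \<otimes>\<^bsub>G\<^esub> y) $ base = x $ base + y $ pos x"
  by (simp add: mult_G perm_action_def pos_def)

lemma pos_add_one: "x \<in> C \<Longrightarrow> pos (x + 1) = pos x"
  using pi_comp[of x 1] one_mem by (simp add: pos_def mult_one pi_one)

lemma pi_pos: "x \<in> C \<Longrightarrow> \<pi> x (pos x) = base"
  using bij_pi[of x] by (simp add: pos_def bij_is_surj surj_f_inv_f)

text \<open>The quotient of \<open>x\<close> and \<open>y\<close> fixes the coordinate
  \<open>pos x\<close>, so by fixed-point freeness it is 0 or 1.\<close>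

lemma pos_eqD:
  assumes x: "x \<in> C" and y: "y \<in> C" and eq: "pos x = pos y"
  shows "y = x \<or> y = x + 1"
proof -
  define z where "z = inv\<^bsub>G\<^esub> x \<otimes>\<^bsub>G\<^esub> y"
  have z: "z \<in> C" "y = x \<otimes>\<^bsub>G\<^esub> z"
    using x y unfolding z_def by (auto simp flip: m_assoc)
  have "\<pi> x (pos x) = base" "\<pi> y (pos x) = base"
    using pi_pos[OF x] pi_pos[OF y] eq by simp_all
  then have "\<pi> x (\<pi> z (pos x)) = \<pi> x (pos x)"
    using pi_comp[OF x z(1)] z(2) by simp
  then have "\<pi> z (pos x) = pos x"
    using bij_pi[OF x] by (meson bij_is_inj injD)
  then have "z \<in> {0, 1}" using pi_free z(1) by blast
  then show ?thesis using z(2) x by (auto simp: mult_one)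
qed

lemma gen_mem: "a \<in> C" "b \<in> C"
proof -
  have "case_gen a b g \<in> C" for g
    using presentation unfolding has_presentation_def by (simp add: image_subset_iff)
  from this[of Gen_a] this[of Gen_b] show "a \<in> C" "b \<in> C" by simp_all
qed

lemma generate_G: "generate G {a, b} = C"
proof -
  have "UNIV = {Gen_a, Gen_b}" using gen.exhaust by blast
  then have "range (case_gen a b) = case_gen a b ` {Gen_a, Gen_b}" by (rule arg_cong)
  then have "range (case_gen a b) = {a, b}" by simp
  then show ?thesis
    using presentation unfolding has_presentation_def by simp
qed

lemma relation:
  "(l, r) \<in> type_Q_relations n \<Longrightarrow> gword_eval G (case_gen a b) l = gword_eval G (case_gen a b) r"
  using presentation pc_relation[of l r "type_Q_relations n" "[]" "[]"]
  unfolding has_presentation_def by simp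

lemma a_pow_4n: "a [^]\<^bsub>G\<^esub> (4 * n) = 0"
  using relation[of "replicate (4 * n) (Gen_a, True)" "[]"] gen_mem
    gword_eval_replicate[OF is_group, of "case_gen a b" Gen_a "4 * n"]
  by (simp add: type_Q_relations_def gword_eval_def)

lemma b_square: "b \<otimes>\<^bsub>G\<^esub> b = a [^]\<^bsub>G\<^esub> (2 * n)"
  using relation[of "replicate (2 * n) (Gen_a, True)" "[(Gen_b, True), (Gen_b, True)]"] gen_mem
    gword_eval_replicate[OF is_group, of "case_gen a b" Gen_a "2 * n"]
  by (simp add: type_Q_relations_def gword_eval_def)

lemma b_conj: "inv\<^bsub>G\<^esub> b \<otimes>\<^bsub>G\<^esub> (a \<otimes>\<^bsub>G\<^esub> b) = inv\<^bsub>G\<^esub> a"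
  using relation[of "[(Gen_b, False), (Gen_a, True), (Gen_b, True)]" "[(Gen_a, False)]"] gen_mem
  by (simp add: type_Q_relations_def gword_eval_def)

section \<open>Normal forms in the dicyclic group\<close>

definition A :: "int \<Rightarrow> bit ^ 'm" where
  "A k = a [^]\<^bsub>G\<^esub> k"

definition B :: "int \<Rightarrow> bit ^ 'm" where
  "B k = A k \<otimes>\<^bsub>G\<^esub> b"

lemma A_mem [simp]: "A k \<in> C" and B_mem [simp]: "B k \<in> C"
  using gen_mem int_pow_closed[of a k] m_closed[of "A k" b] by (simp_all add: A_def B_def)

lemma A_add: "A k \<otimes>\<^bsub>G\<^esub> A l = A (k + l)"
  using gen_mem by (simp add: A_def int_pow_mult)

lemma A_0 [simp]: "A 0 = 0" and A_1: "A 1 = a"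
  using gen_mem by (simp_all add: A_def)

lemma B_0: "B 0 = b"
  using gen_mem by (simp add: B_def)

lemma A_period: "A (k + 4 * int n) = A k"
proof -
  have "A (4 * int n) = 0"
    using a_pow_4n int_pow_int[of G a "4 * n"] by (simp add: A_def)
  then show ?thesis using A_add[of k "4 * int n"] by simp
qed

lemma A_period_mult: "A (k + 4 * int n * q) = A k"
proof (induction q rule: int_induct[where k = 0])
  case (step1 i)
  then show ?case using A_period[of "k + 4 * int n * i"] by (simp add: algebra_simps)
next
  case (step2 i)
  then show ?case using A_period[of "k + 4 * int n * (i - 1)"] by (simp add: algebra_simps)
qed simp

lemma A_inv: "inv\<^bsub>G\<^esub> a = A (- 1)"
  using gen_mem int_pow_neg[of a 1] by (simp add: A_def)

lemma b_b: "b \<otimes>\<^bsub>G\<^esub> b = A (2 * int n)"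
  using b_square int_pow_int[of G a "2 * n"] by (simp add: A_def)

lemma a_b: "a \<otimes>\<^bsub>G\<^esub> b = b \<otimes>\<^bsub>G\<^esub> A (- 1)"
proof -
  have "b \<otimes>\<^bsub>G\<^esub> (inv\<^bsub>G\<^esub> b \<otimes>\<^bsub>G\<^esub> (a \<otimes>\<^bsub>G\<^esub> b)) = a \<otimes>\<^bsub>G\<^esub> b"
    using gen_mem by (simp flip: m_assoc)
  then show ?thesis by (simp add: b_conj A_inv)
qed

lemma a_b': "A (- 1) \<otimes>\<^bsub>G\<^esub> b = b \<otimes>\<^bsub>G\<^esub> a"
proof -
  have "A (- 1) \<otimes>\<^bsub>G\<^esub> b = A (- 1) \<otimes>\<^bsub>G\<^esub> (b \<otimes>\<^bsub>G\<^esub> (A (- 1) \<otimes>\<^bsub>G\<^esub> A 1))"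
    using gen_mem by (simp add: A_add)
  also have "\<dots> = A (- 1) \<otimes>\<^bsub>G\<^esub> ((b \<otimes>\<^bsub>G\<^esub> A (- 1)) \<otimes>\<^bsub>G\<^esub> A 1)"
    using gen_mem by (simp add: m_assoc)
  also have "\<dots> = A (- 1) \<otimes>\<^bsub>G\<^esub> ((A 1 \<otimes>\<^bsub>G\<^esub> b) \<otimes>\<^bsub>G\<^esub> A 1)"
    using a_b by (simp add: A_1)
  also have "\<dots> = (A (- 1) \<otimes>\<^bsub>G\<^esub> A 1) \<otimes>\<^bsub>G\<^esub> (b \<otimes>\<^bsub>G\<^esub> A 1)"
    using gen_mem by (simp add: m_assoc)
  also have "\<dots> = b \<otimes>\<^bsub>G\<^esub> a"
    using gen_mem by (simp add: A_add, simp add: A_1)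
  finally show ?thesis .
qed

lemma b_A: "b \<otimes>\<^bsub>G\<^esub> A k = A (- k) \<otimes>\<^bsub>G\<^esub> b"
proof (induction k rule: int_induct[where k = 0])
  case base
  show ?case using gen_mem by simp
next
  case (step1 i)
  have "b \<otimes>\<^bsub>G\<^esub> A (i + 1) = (b \<otimes>\<^bsub>G\<^esub> A i) \<otimes>\<^bsub>G\<^esub> A 1"
    using gen_mem by (simp add: m_assoc A_add)
  also have "\<dots> = A (- i) \<otimes>\<^bsub>G\<^esub> (b \<otimes>\<^bsub>G\<^esub> A 1)"
    using gen_mem step1 by (simp add: m_assoc)
  also have "b \<otimes>\<^bsub>G\<^esub> A 1 = A (- 1) \<otimes>\<^bsub>G\<^esub> b" by (simp add: A_1 a_b')
  also have "A (- i) \<otimes>\<^bsub>G\<^esub> (A (- 1) \<otimes>\<^bsub>G\<^esub> b) = A (- (i + 1)) \<otimes>\<^bsub>G\<^esub> b"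
    using gen_mem A_add[of "- i" "- 1"] by (simp flip: m_assoc)
  finally show ?case .
next
  case (step2 i)
  have "b \<otimes>\<^bsub>G\<^esub> A (i - 1) = (b \<otimes>\<^bsub>G\<^esub> A i) \<otimes>\<^bsub>G\<^esub> A (- 1)"
    using gen_mem by (simp add: m_assoc A_add)
  also have "\<dots> = A (- i) \<otimes>\<^bsub>G\<^esub> (b \<otimes>\<^bsub>G\<^esub> A (- 1))"
    using gen_mem step2 by (simp add: m_assoc)
  also have "b \<otimes>\<^bsub>G\<^esub> A (- 1) = A 1 \<otimes>\<^bsub>G\<^esub> b" by (simp add: A_1 a_b)
  also have "A (- i) \<otimes>\<^bsub>G\<^esub> (A 1 \<otimes>\<^bsub>G\<^esub> b) = A (- (i - 1)) \<otimes>\<^bsub>G\<^esub> b"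
    using gen_mem A_add[of "- i" "1"] by (simp flip: m_assoc)
  finally show ?case .
qed

lemma A_B: "A k \<otimes>\<^bsub>G\<^esub> B l = B (k + l)"
  using gen_mem by (simp add: B_def A_add flip: m_assoc)

lemma B_A: "B k \<otimes>\<^bsub>G\<^esub> A l = B (k - l)"
proof -
  have "B k \<otimes>\<^bsub>G\<^esub> A l = A k \<otimes>\<^bsub>G\<^esub> (A (- l) \<otimes>\<^bsub>G\<^esub> b)"
    using gen_mem by (simp add: B_def m_assoc b_A)
  then show ?thesis using gen_mem A_add[of k "- l"] by (simp add: B_def flip: m_assoc)
qed

lemma B_B: "B k \<otimes>\<^bsub>G\<^esub> B l = A (k - l + 2 * int n)"
proof -
  have "B k \<otimes>\<^bsub>G\<^esub> B l = (B k \<otimes>\<^bsub>G\<^esub> A l) \<otimes>\<^bsub>G\<^esub> b"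
    using gen_mem by (simp add: B_def[of l] m_assoc)
  also have "\<dots> = A (k - l) \<otimes>\<^bsub>G\<^esub> (b \<otimes>\<^bsub>G\<^esub> b)"
    unfolding B_A using gen_mem by (simp add: B_def m_assoc)
  finally show ?thesis by (simp add: b_b A_add)
qed

lemma generate_cases: "x \<in> generate G {a, b} \<Longrightarrow> (\<exists>k. x = A k) \<or> (\<exists>k. x = B k)"
proof (induction rule: generate.induct)
  case one
  show ?case using A_0 by (intro disjI1 exI[of _ 0]) simp
next
  case (incl h)
  then have "h = A 1 \<or> h = B 0" by (auto simp: A_1 B_0)
  then show ?case by blast
next
  case (inv h)
  \<comment> \<open>The exponent compensates the square \<open>b^2 = a^(2n)\<close>.\<close>
  have "inv\<^bsub>G\<^esub> b = B (- 2 * int n)"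
  proof (rule inv_equality)
    show "B (- 2 * int n) \<otimes>\<^bsub>G\<^esub> b = \<one>\<^bsub>G\<^esub>"
      using B_B[of "- 2 * int n" 0] by (simp add: B_0)
  qed (use gen_mem in simp_all)
  with inv A_inv show ?case by auto
next
  case (eng h1 h2)
  then show ?case
    by (elim disjE exE; simp only: A_add A_B B_A B_B; blast)
qed

lemma C_cases:
  assumes "x \<in> C"
  obtains k where "x = A k" | k where "x = B k"
  using generate_cases[of x] assms generate_G by auto


definition elt :: "nat \<times> bool \<Rightarrow> bit ^ 'm" where
  "elt = (\<lambda>(i, e). if e then B (int i) else A (int i))"

lemma elt_mem [simp]: "elt x \<in> C"
  by (simp add: elt_def split: prod.splits)

lemma A_mod: "A (k mod (4 * int n)) = A k"
  using A_period_mult[of "k mod (4 * int n)" "k div (4 * int n)"] by simp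

lemma B_mod: "B (k mod (4 * int n)) = B k"
  by (simp add: B_def A_mod)

lemma elt_mod:
  "A k = elt (nat (k mod (4 * int n)), False)" "B k = elt (nat (k mod (4 * int n)), True)"
  using n_pos by (simp_all add: elt_def A_mod B_mod)

lemma elt_mod_mem: "(nat (k mod (4 * int n)), e) \<in> {..<4 * n} \<times> UNIV"
proof -
  have "0 \<le> k mod (4 * int n)" "k mod (4 * int n) < 4 * int n" using n_pos by simp_all
  then have "nat (k mod (4 * int n)) < 4 * n" by linarith
  then show ?thesis by simp
qed

text \<open>The \<open>8 n\<close> normal forms exhaust \<open>C\<close>, which has
  \<open>8 n\<close> elements, so they are distinct.\<close>

lemma inj_elt: "inj_on elt ({..<4 * n} \<times> UNIV)"
proof (rule eq_card_imp_inj_on)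
  have "C \<subseteq> elt ` ({..<4 * n} \<times> UNIV)"
  proof
    fix x assume "x \<in> C"
    then show "x \<in> elt ` ({..<4 * n} \<times> UNIV)"
    proof (cases rule: C_cases)
      case (1 k)
      show ?thesis unfolding 1 elt_mod(1) by (rule imageI, rule elt_mod_mem)
    next
      case (2 k)
      show ?thesis unfolding 2 elt_mod(2) by (rule imageI, rule elt_mod_mem)
    qed
  qed
  moreover have "elt ` ({..<4 * n} \<times> UNIV) \<subseteq> C" by auto
  ultimately have "elt ` ({..<4 * n} \<times> UNIV) = C" by blast
  then show "card (elt ` ({..<4 * n} \<times> UNIV)) = card ({..<4 * n} \<times> (UNIV :: bool set))"
    using hadamard_code_card[OF hadamard] card_index by (simp add: card_cartesian_product)
qed simp

lemma A_eq_zero_dvd: "A k = 0 \<Longrightarrow> 4 * int n dvd k"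
  using inj_onD[OF inj_elt _ elt_mod_mem elt_mod_mem, of k False 0 False] elt_mod(1)[of k] elt_mod(1)[of 0] n_pos
  by (simp add: nat_eq_iff dvd_eq_mod_eq_0 split: if_splits)

text \<open>The word 1 is an involution of the group, and \<open>a^(2n)\<close> is the only one:
  each \<open>a^k b\<close> has square \<open>a^(2n)\<close>, which is not the identity.\<close>

lemma one_eq_A: "1 = A (2 * int n)"
proof -
  have sq: "1 \<otimes>\<^bsub>G\<^esub> 1 = 0" by (simp add: mult_one)
  from one_mem show ?thesis
  proof (cases rule: C_cases)
    case (1 k)
    have "A (k + k) = A k \<otimes>\<^bsub>G\<^esub> A k" by (simp only: A_add)
    also have "\<dots> = 0" using sq by (simp only: 1[symmetric])
    finally have "A (k + k) = 0" .
    then have "4 * int n dvd k + k" by (rule A_eq_zero_dvd)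
    then have "2 * (2 * int n) dvd 2 * k" by simp
    then have "2 * int n dvd k" by (subst (asm) dvd_mult_cancel_left) simp
    then obtain q where q: "k = 2 * int n * q" by blast
    show ?thesis
    proof (cases "even q")
      case True
      then obtain q' where "q = 2 * q'" by blast
      then have "A k = 0" using q A_period_mult[of 0 q'] by (simp add: ac_simps)
      with 1 show ?thesis by simp
    next
      case False
      then obtain q' where "q = 2 * q' + 1" by (elim oddE)
      then have "k = 2 * int n + 4 * int n * q'" using q by (simp add: algebra_simps)
      then show ?thesis using 1 A_period_mult[of "2 * int n" q'] by simp
    qed
  next
    case (2 k)
    have "A (2 * int n) = B k \<otimes>\<^bsub>G\<^esub> B k" by (simp add: B_B)
    also have "\<dots> = 0" using sq by (simp only: 2[symmetric])
    finally have "A (2 * int n) = 0" .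
    then have "4 * int n dvd 2 * int n" by (rule A_eq_zero_dvd)
    then show ?thesis using n_pos by (auto dest: zdvd_imp_le)
  qed
qed

lemma A_half_period: "A (k + 2 * int n) = A k + 1"
  using A_add[of k "2 * int n"] by (simp add: mult_one flip: one_eq_A)

lemma B_half_period: "B (k + 2 * int n) = B k + 1"
  using A_B[of "2 * int n" k] by (simp add: add.commute mult_G pi_one perm_action_simps flip: one_eq_A)

text \<open>Only \<open>x\<close> and its complement, the product with \<open>a^(2n)\<close>, share
  a position. Half of the normal forms therefore label all \<open>4 n\<close> coordinates
  once.\<close>

lemma bij_pos_elt: "bij_betw (\<lambda>x. pos (elt x)) ({..<2 * n} \<times> UNIV) UNIV"
proof -
  have "inj_on (\<lambda>x. pos (elt x)) ({..<2 * n} \<times> UNIV)"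
  proof (rule inj_onI)
    fix x y :: "nat \<times> bool"
    assume x: "x \<in> {..<2 * n} \<times> UNIV" and y: "y \<in> {..<2 * n} \<times> UNIV" and eq: "pos (elt x) = pos (elt y)"
    obtain i e where xi: "x = (i, e)" by (cases x)
    have "elt x + 1 = elt (i + 2 * n, e)"
      using A_half_period[of "int i"] B_half_period[of "int i"] by (simp add: xi elt_def)
    then have "elt y = elt x \<or> elt y = elt (i + 2 * n, e)"
      using pos_eqD[OF elt_mem elt_mem eq] by auto
    moreover have "x \<in> {..<4 * n} \<times> UNIV" "y \<in> {..<4 * n} \<times> UNIV" "(i + 2 * n, e) \<in> {..<4 * n} \<times> UNIV"
      using x y xi by auto
    ultimately have "y = x \<or> y = (i + 2 * n, e)"
      using inj_onD[OF inj_elt] by blast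
    then show "x = y" using y by auto
  qed
  moreover from this have "(\<lambda>x. pos (elt x)) ` ({..<2 * n} \<times> UNIV) = UNIV"
    by (intro card_subset_eq) (simp_all add: card_image card_cartesian_product card_index)
  ultimately show ?thesis by (simp add: bij_betw_def)
qed

lemma pos_surj:
  obtains k where "j = pos (A k)" | k where "j = pos (B k)"
proof -
  have "j \<in> (\<lambda>x. pos (elt x)) ` ({..<2 * n} \<times> UNIV)"
    using bij_pos_elt by (simp add: bij_betw_def)
  then obtain i e where "j = pos (elt (i, e))" by auto
  with that show ?thesis by (cases e) (auto simp: elt_def)
qed

lemma eqI_pos:
  assumes "\<And>k. x $ pos (A k) = y $ pos (A k)" "\<And>k. x $ pos (B k) = y $ pos (B k)"
  shows "x = y"
  unfolding vec_eq_iff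
proof
  fix j show "x $ j = y $ j"
    by (cases j rule: pos_surj) (simp_all add: assms)
qed

section \<open>The sequences of first coordinates\<close>

definition s :: "int \<Rightarrow> bit" where "s k = A k $ base"
definition r :: "int \<Rightarrow> bit" where "r k = B k $ base"

sublocale orthogonal_negaperiodic_pair n s r
proof
  show "n > 0" by (rule n_pos)
  show "s (k + 2 * int n) = s k + 1" "r (k + 2 * int n) = r k + 1" for k
    by (simp_all add: s_def r_def A_half_period B_half_period)
  show "(\<Sum>i<2 * n. sg (s (int i) + s (int i + m)) + sg (r (int i) + r (int i + m))) = 0"
    if m: "\<not> 2 * int n dvd m" for m
  proof -
    have "\<not> 4 * int n dvd m" "\<not> 4 * int n dvd m - 2 * int n"
    proof -
      show "\<not> 4 * int n dvd m"
        using m dvd_trans[of "2 * int n" "4 * int n" m] by auto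
      show "\<not> 4 * int n dvd m - 2 * int n"
      proof
        assume "4 * int n dvd m - 2 * int n"
        then obtain q where "m - 2 * int n = 4 * int n * q" by (elim dvdE)
        then have "m = 2 * int n * (2 * q + 1)" by (simp add: algebra_simps)
        with m show False by simp
      qed
    qed
    have ne: "A m \<noteq> 0" "A m \<noteq> 0 + 1"
    proof -
      show "A m \<noteq> 0" using A_eq_zero_dvd \<open>\<not> 4 * int n dvd m\<close> by blast
      have "A (m - 2 * int n) = A m + 1"
        using A_half_period[of "m - 2 * int n"] by simp
      moreover have "A (m - 2 * int n) \<noteq> 0"
        using A_eq_zero_dvd \<open>\<not> 4 * int n dvd m - 2 * int n\<close> by blast
      ultimately show "A m \<noteq> 0 + 1" by auto
    qed
    define h where "h k = sg (r k + r (k + m))" for k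
    have hp: "h (k + int (2 * n)) = h k" for k
      using B_half_period[of k] B_half_period[of "k + m"] by (simp add: h_def r_def algebra_simps)
    have pos_A: "sg (A m $ pos (A k)) = sg (s k + s (k + m))" for k
      using mult_base[of "A k" "A m"] by (simp add: A_add s_def)
    \<comment> \<open>Here the shift is by \<open>- m\<close> because
      \<open>a^k b a^m = a^(k-m) b\<close>; periodicity of \<open>h\<close> removes the offset from
      the sum.\<close>
    have pos_B: "sg (A m $ pos (B k)) = h (k + (- m))" for k
      using mult_base[of "B k" "A m"] by (simp add: B_A r_def h_def add.commute)
    have "(\<Sum>j\<in>UNIV. sg (A m $ j)) = 0"
      using hadamard_code_orthogonal[OF hadamard A_mem zero_mem ne] by simp
    also have "(\<Sum>j\<in>UNIV. sg (A m $ j)) = (\<Sum>x\<in>{..<2 * n} \<times> UNIV. sg (A m $ pos (elt x)))"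
      by (rule sum.reindex_bij_betw[OF bij_pos_elt, symmetric])
    also have "\<dots> = (\<Sum>i<2 * n. sg (A m $ pos (A (int i)))) + (\<Sum>i<2 * n. sg (A m $ pos (B (int i))))"
      by (simp add: sum.cartesian_product' UNIV_bool elt_def sum.distrib)
    also have "\<dots> = (\<Sum>i<2 * n. sg (s (int i) + s (int i + m))) + (\<Sum>i<2 * n. h (int i + (- m)))"
      by (simp only: pos_A pos_B)
    also have "(\<Sum>i<2 * n. h (int i + (- m))) = (\<Sum>i<2 * n. h (int i))"
      using hp by (rule sum_periodic_shift)
    finally show ?thesis by (simp add: h_def sum.distrib)
  qed
qed

section \<open>Translates and the kernel of the code\<close>

lemma right_translate_iff:
  "right_translate x y \<longleftrightarrow>
     (\<exists>g\<in>C. \<forall>k. x k = (A k \<otimes>\<^bsub>G\<^esub> g) $ base \<and> y k = (B k \<otimes>\<^bsub>G\<^esub> g) $ base)"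
proof -
  have "(\<exists>g\<in>C. P g) \<longleftrightarrow> (\<exists>p. P (A p) \<or> P (B p))" for P
    using C_cases A_mem B_mem by metis
  moreover have "A (k - l + 2 * int n) $ base = s (k - l) + 1" for k l
    by (simp add: s_def A_half_period)
  ultimately show ?thesis
    unfolding right_translate_def by (simp add: A_add A_B B_A B_B) (simp add: s_def r_def)
qed

lemma left_translate_iff:
  "left_translate x y \<longleftrightarrow>
     (\<exists>g\<in>C. \<forall>k. x k = (g \<otimes>\<^bsub>G\<^esub> A k) $ base \<and> y k = (g \<otimes>\<^bsub>G\<^esub> B k) $ base)"
proof -
  have "(\<exists>g\<in>C. P g) \<longleftrightarrow> (\<exists>p. P (A p) \<or> P (B p))" for P
    using C_cases A_mem B_mem by metis
  moreover have "A (k - l + 2 * int n) $ base = s (k - l) + 1" for k l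
    by (simp add: s_def A_half_period)
  ultimately show ?thesis
    unfolding left_translate_def by (simp add: A_add A_B B_A B_B) (simp add: s_def r_def add.commute)
qed

text \<open>By \<open>mult_base\<close>, adding \<open>z\<close> to a codeword \<open>g\<close> adds
  exactly the entries of \<open>z\<close> at the labelled positions to the right translate given by
  \<open>g\<close>.\<close>

lemma right_kernel_of_code_kernel:
  assumes "z \<in> code_kernel C"
  shows "right_kernel (\<lambda>k. z $ pos (A k)) (\<lambda>k. z $ pos (B k))"
  unfolding right_kernel_def right_translate_iff
proof (intro allI impI)
  fix x y
  assume "\<exists>g\<in>C. \<forall>k. x k = (A k \<otimes>\<^bsub>G\<^esub> g) $ base \<and> y k = (B k \<otimes>\<^bsub>G\<^esub> g) $ base"
  then obtain g where g: "g \<in> C"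
    "\<And>k. x k = (A k \<otimes>\<^bsub>G\<^esub> g) $ base" "\<And>k. y k = (B k \<otimes>\<^bsub>G\<^esub> g) $ base"
    by blast
  have "g + z \<in> C" using assms g(1) by (simp add: code_kernel_iff[OF zero_mem])
  then show "\<exists>g\<in>C. \<forall>k. x k + z $ pos (A k) = (A k \<otimes>\<^bsub>G\<^esub> g) $ base \<and>
      y k + z $ pos (B k) = (B k \<otimes>\<^bsub>G\<^esub> g) $ base"
    by (intro bexI[of _ "g + z"]) (simp_all add: g mult_base add.assoc)
qed

lemma code_kernel_of_right_kernel:
  assumes "right_kernel t t'"
  obtains z where "z \<in> code_kernel C" "\<And>k. t k = z $ pos (A k)" "\<And>k. t' k = z $ pos (B k)"
proof -
  have ex: "\<exists>h\<in>C. \<forall>k. g $ pos (A k) + t k = h $ pos (A k) \<and> g $ pos (B k) + t' k = h $ pos (B k)"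
    if g: "g \<in> C" for g
  proof -
    have "right_translate (\<lambda>k. (A k \<otimes>\<^bsub>G\<^esub> g) $ base) (\<lambda>k. (B k \<otimes>\<^bsub>G\<^esub> g) $ base)"
      using g unfolding right_translate_iff by blast
    then have "right_translate (\<lambda>k. (A k \<otimes>\<^bsub>G\<^esub> g) $ base + t k) (\<lambda>k. (B k \<otimes>\<^bsub>G\<^esub> g) $ base + t' k)"
      using assms unfolding right_kernel_def by blast
    then show ?thesis
      unfolding right_translate_iff by (simp add: mult_base add.assoc)
  qed
  obtain z where z: "z \<in> C" "\<And>k. t k = z $ pos (A k)" "\<And>k. t' k = z $ pos (B k)"
    using ex[OF zero_mem] by auto
  have "g + z \<in> C" if g: "g \<in> C" for g
  proof -
    obtain h where "h \<in> C" "\<And>k. g $ pos (A k) + t k = h $ pos (A k)"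
      "\<And>k. g $ pos (B k) + t' k = h $ pos (B k)"
      using ex[OF g] by blast
    moreover from this have "g + z = h"
      by (intro eqI_pos) (simp_all add: z)
    ultimately show ?thesis by simp
  qed
  with z(1) have "z \<in> code_kernel C" by (simp add: code_kernel_iff[OF zero_mem])
  then show ?thesis using z(2,3) by (rule that)
qed

lemma const_pair_pos_iff:
  "const_pair (\<lambda>k. z $ pos (A k)) (\<lambda>k. z $ pos (B k)) \<longleftrightarrow> z \<in> {0, 1}"
proof
  assume "const_pair (\<lambda>k. z $ pos (A k)) (\<lambda>k. z $ pos (B k))"
  then obtain c where "\<And>k. z $ pos (A k) = c" "\<And>k. z $ pos (B k) = c"
    unfolding const_pair_def by blast
  then have "z = vec c" by (intro eqI_pos) simp_all
  then show "z \<in> {0, 1}" by (cases "c = 0") (simp_all add: vec_eq_iff)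
qed (auto simp: const_pair_def)

lemma one_code_kernel: "1 \<in> code_kernel C"
  using add_one_mem by (rule code_kernel_add_one_closed)

lemma small_kernel:
  assumes dim: "vec.dim (code_kernel C) = 2"
  shows "small_kernel_pair n s r"
proof
  obtain z where "z \<in> code_kernel C" "z \<notin> {0, 1}"
    using dim_two_bit(1)[OF dim one_code_kernel] by blast
  then show "\<exists>t t'. right_kernel t t' \<and> \<not> const_pair t t'"
    using right_kernel_of_code_kernel const_pair_pos_iff by blast
next
  fix t t' v v'
  assume t: "right_kernel t t'" and v: "right_kernel v v'"
    and nc: "\<not> const_pair t t'" "\<not> const_pair v v'"
  obtain z where z: "z \<in> code_kernel C" "\<And>k. t k = z $ pos (A k)" "\<And>k. t' k = z $ pos (B k)"
    using t by (rule code_kernel_of_right_kernel) blast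
  obtain w where w: "w \<in> code_kernel C" "\<And>k. v k = w $ pos (A k)" "\<And>k. v' k = w $ pos (B k)"
    using v by (rule code_kernel_of_right_kernel) blast
  have "z \<notin> {0, 1}" "w \<notin> {0, 1}"
    using nc z w by (auto simp: const_pair_def)
  then have "z + w \<in> {0, 1}"
    using dim_two_bit(2)[OF dim one_code_kernel] z(1) w(1) by blast
  then show "const_pair (\<lambda>k. t k + v k) (\<lambda>k. t' k + v' k)"
    using const_pair_pos_iff[of "z + w"] by (simp add: z w)
qed

section \<open>Left translates and the transpose code\<close>

context
  fixes H :: "bit ^ 'm ^ 'm"
  assumes H: "bij_betw (\<lambda>i. row i H) UNIV {x \<in> C. x $ base = 0}"
begin

lemma row_mem: "row i H \<in> C"
  using H bij_betwE by fastforce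

text \<open>Column \<open>pos g\<close> has in row \<open>x\<close> the \<open>base\<close> entry of
  the product of \<open>g\<close> and \<open>x\<close>, up to that of \<open>g\<close>. Passing from
  \<open>g\<close> to \<open>g + 1\<close> keeps the position and complements the word.\<close>

lemma column_code_eq: "column_code H = (\<lambda>g. \<chi> i. (g \<otimes>\<^bsub>G\<^esub> row i H) $ base) ` C"
proof (intro equalityI subsetI)
  fix w assume "w \<in> column_code H"
  then obtain j where "w = column j H \<or> w = column j H + 1"
    unfolding column_code_def with_complements_def columns_def by blast
  then have "w = (\<chi> i. row i H $ j + (if w = column j H then 0 else 1))"
    by (auto simp: vec_eq_iff column_def row_def)
  then obtain c where w: "\<And>i. w $ i = row i H $ j + c"
    by (metis vec_lambda_beta)
  have "\<exists>g\<in>C. j = pos g"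
    by (cases j rule: pos_surj) (use A_mem B_mem in blast)+
  then obtain g where g: "g \<in> C" "j = pos g" by blast
  define g' where "g' = (if g $ base = c then g else g + 1)"
  have "g' \<in> C" "g' $ base = c" "pos g' = j"
    using g add_one_mem[OF g(1)] pos_add_one[OF g(1)] by (cases "c = 0"; auto simp: g'_def)+
  then have "w = (\<chi> i. (g' \<otimes>\<^bsub>G\<^esub> row i H) $ base)"
    by (simp add: vec_eq_iff w mult_base add.commute)
  with \<open>g' \<in> C\<close> show "w \<in> (\<lambda>g. \<chi> i. (g \<otimes>\<^bsub>G\<^esub> row i H) $ base) ` C" by blast
next
  fix w assume "w \<in> (\<lambda>g. \<chi> i. (g \<otimes>\<^bsub>G\<^esub> row i H) $ base) ` C"
  then obtain g where w: "w = (\<chi> i. g $ base + row i H $ pos g)"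
    by (auto simp: mult_base)
  have "w = column (pos g) H \<or> w = column (pos g) H + 1"
    by (cases "g $ base = 0") (simp_all add: w vec_eq_iff column_def row_def add.commute)
  then show "w \<in> column_code H"
    unfolding column_code_def with_complements_def columns_def by blast
qed

text \<open>The rows contain one word from each complementary pair; \<open>idx\<close> finds the one
  representing \<open>x\<close>.\<close>

definition idx :: "bit ^ 'm \<Rightarrow> 'm" where
  "idx x = (SOME i. row i H = x \<or> row i H = x + 1)"

lemma row_idx:
  assumes x: "x \<in> C" shows "row (idx x) H = x \<or> row (idx x) H = x + 1"
proof -
  have surj: "\<exists>i. row i H = y" if "y \<in> C" "y $ base = 0" for y
    using H that unfolding bij_betw_def by (metis (mono_tags, lifting) imageE mem_Collect_eq)
  have "\<exists>i. row i H = x \<or> row i H = x + 1"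
  proof (cases "x $ base = 0")
    case False
    then show ?thesis using surj[of "x + 1"] add_one_mem[OF x] by auto
  qed (use surj x in blast)
  then show ?thesis unfolding idx_def by (rule someI_ex)
qed

lemma idx_row: "idx (row i H) = i"
proof -
  have base0: "row i H $ base = 0" for i
    using H bij_betwE by fastforce
  have "row (idx (row i H)) H = row i H"
    using row_idx[OF row_mem, of i] base0[of "idx (row i H)"] base0[of i] by auto
  then show ?thesis
    using H unfolding bij_betw_def by (meson UNIV_I inj_onD)
qed

text \<open>The words of the transpose code are left translates sampled at the rows of
  \<open>H\<close>. Complementing the second factor changes two left translates alike, so a relation
  on rows extends to all of \<open>C\<close>.\<close>

lemma left_kernel_of_column_kernel:
  assumes "z \<in> code_kernel (column_code H)"
  shows "left_kernel (\<lambda>k. z $ idx (A k)) (\<lambda>k. z $ idx (B k))"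
  unfolding left_kernel_def left_translate_iff
proof (intro allI impI)
  fix x y
  assume "\<exists>g\<in>C. \<forall>k. x k = (g \<otimes>\<^bsub>G\<^esub> A k) $ base \<and> y k = (g \<otimes>\<^bsub>G\<^esub> B k) $ base"
  then obtain g where g: "g \<in> C"
    "\<And>k. x k = (g \<otimes>\<^bsub>G\<^esub> A k) $ base" "\<And>k. y k = (g \<otimes>\<^bsub>G\<^esub> B k) $ base"
    by blast
  have "(\<chi> i. (g \<otimes>\<^bsub>G\<^esub> row i H) $ base) + z \<in> column_code H"
    using assms g(1) unfolding code_kernel_def column_code_eq by blast
  then obtain h where h: "h \<in> C"
    "(\<chi> i. (g \<otimes>\<^bsub>G\<^esub> row i H) $ base) + z = (\<chi> i. (h \<otimes>\<^bsub>G\<^esub> row i H) $ base)"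
    unfolding column_code_eq by blast
  have row: "g $ base + row i H $ pos g + z $ i = h $ base + row i H $ pos h" for i
    using h(2) by (simp add: vec_eq_iff mult_base)
  have "(g \<otimes>\<^bsub>G\<^esub> v) $ base + z $ idx v = (h \<otimes>\<^bsub>G\<^esub> v) $ base" if "v \<in> C" for v
  proof -
    from row_idx[OF that] show ?thesis
    proof
      assume "row (idx v) H = v"
      with row[of "idx v"] show ?thesis by (simp add: mult_base)
    next
      assume "row (idx v) H = v + 1"
      with row[of "idx v"] show ?thesis by (simp add: mult_base ac_simps)
    qed
  qed
  then show "\<exists>g\<in>C. \<forall>k. x k + z $ idx (A k) = (g \<otimes>\<^bsub>G\<^esub> A k) $ base \<and>
      y k + z $ idx (B k) = (g \<otimes>\<^bsub>G\<^esub> B k) $ base"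
    using h(1) g by (intro bexI[of _ h]) simp_all
qed

text \<open>Every coordinate is \<open>idx\<close> of some \<open>a^k\<close> or
  \<open>a^k b\<close>, so a constant pair comes from a constant word.\<close>

lemma column_kernel_trivial:
  assumes "vec.dim (code_kernel C) = 2"
  shows "code_kernel (column_code H) = {0, 1}"
proof (intro equalityI subsetI)
  interpret small_kernel_pair n s r using assms by (rule small_kernel)
  fix z assume "z \<in> code_kernel (column_code H)"
  then have "const_pair (\<lambda>k. z $ idx (A k)) (\<lambda>k. z $ idx (B k))"
    by (intro left_kernel_trivial left_kernel_of_column_kernel)
  then obtain c where c: "\<And>k. z $ idx (A k) = c" "\<And>k. z $ idx (B k) = c"
    unfolding const_pair_def by blast
  have "z $ i = c" for i
    using row_mem[of i] by (cases rule: C_cases) (use c idx_row[of i] in metis)+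
  then show "z \<in> {0, 1}" by (cases "c = 0") (simp_all add: vec_eq_iff)
next
  fix z :: "bit ^ 'm" assume "z \<in> {0, 1}"
  moreover have "0 \<in> code_kernel (column_code H)" by (simp add: code_kernel_def)
  moreover have "1 \<in> code_kernel (column_code H)"
    by (rule code_kernel_add_one_closed) (simp add: column_code_def with_complements_add_one)
  ultimately show "z \<in> code_kernel (column_code H)" by blast
qed

end

end

theorem theorem2:
  fixes n :: nat
    and C :: "(bit ^ 'm::{finite,linorder}) set"
    and \<pi> :: "bit ^ ('m::{finite,linorder}) \<Rightarrow> 'm \<Rightarrow> 'm"
    and a b :: "bit ^ ('m::{finite,linorder})"
    and H :: "bit ^ ('m::{finite,linorder}) ^ ('m::{finite,linorder})"
  assumes "hfp_code_type_Q n C \<pi> a b"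
    and "vec.dim (code_kernel C) = 2"
    and "row_matrix_of_code C H"
  shows "vec.dim (code_kernel (column_code H)) = 1"
proof -
  interpret hfp_type_Q n C \<pi> a b "Min UNIV"
    by unfold_locales (rule assms(1))
  have "code_kernel (column_code H) = {0, 1}"
    using assms(3) assms(2) unfolding row_matrix_of_code_def by (rule column_kernel_trivial)
  then show ?thesis by (simp add: dim_zero_one_bit)
qed

end
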